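(* Let $D\subset\mathbb{R}^3$ be an open set and let $\phi:D\to\mathbb{R}$ be a $C^1$ function such that: (1) $\phi$ is non-stationary and satisfies the angle monotonicity condition; (2) $\phi$ and $\nabla_x\phi$ both extend continuously to the closure $\overline D$, and (the extension of) $\nabla_x\phi$ is nonzero on $\overline D$; (3) $D_\alpha$ is convex for all $\alpha\in\mathbb{R}$. Suppose $\{F_\alpha\}_{\alpha\in\mathbb{R}}$ is a family of subsets of $\mathbb{R}$ such that $F_\alpha\subset\phi_\alpha(D_\alpha)$ for each $\alpha$, and $\bigcup_{\alpha\in\mathbb{R}}(\{\alpha\}\times F_\alpha)$ is a (Lebesgue) measurable subset of $\mathbb{R}^2$. Then there exists a Borel set $E\subset\mathbb{R}^2$ such that $$\phi_\alpha(E\cap D_\alpha)\supset F_\alpha\quad\text{for all }\alpha\in\mathbb{R},$$ $$|\phi_\alpha(E\cap D_\alpha)\setminus F_\alpha|=0\quad\text{for almost every }\alpha\in\mathbb{R}.$$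
   Context: View $\mathbb{R}^3$ as $\mathbb{R}\times\mathbb{R}^2$ with points written $(\alpha,x)$, $x=(x_1,x_2)$. For an open set $D\subset\mathbb{R}^3$ and $\phi:D\to\mathbb{R}$, put $D_\alpha=\{x\in\mathbb{R}^2:(\alpha,x)\in D\}$ and $\phi_\alpha:D_\alpha\to\mathbb{R}$, $\phi_\alpha(x)=\phi(\alpha,x)$. $\nabla\phi_\alpha(x)=\nabla_x\phi(\alpha,x)$ is the gradient in the $x$-variable only. $|\cdot|$ denotes Lebesgue measure. Non-stationary: $\nabla\phi_\alpha(x)\neq0$ for all $(\alpha,x)\in D$. Directions: an element $\theta\in\mathbb{R}/\pi\mathbb{Z}$ is identified with the unoriented direction $\pm(\cos\theta,\sin\theta)$ in $\mathbb{R}^2$. For non-stationary $C^1$ $\phi$, $\theta_\alpha(x)\in\mathbb{R}/\pi\mathbb{Z}$ is the direction perpendicular to $\nabla\phi_\alpha(x)$ (the tangent direction at $x$ of the level curve of $\phi_\alpha$ through $x$). Angle monotonicity condition: for each fixed $x$ there is a choice of representatives $[a,a+\pi)$ for $\mathbb{R}/\pi\mathbb{Z}$ such that $\alpha\mapsto\theta_\alpha(x)$ is a strictly increasing function $\{\alpha:(\alpha,x)\in D\}\to[a,a+\pi)$. *)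

theory Defs
  imports "HOL-Analysis.Analysis"
begin

text \<open>
  Three-space is viewed as \<^typ>\<open>real \<times> (real^2)\<close>, with points \<open>(\<alpha>, x)\<close>. A function on a set
  \<open>D\<close> is a total HOL function; for open \<open>D\<close>, the conditions below do not depend on its values
  outside \<open>D\<close>.
\<close>

definition slice :: "(real \<times> (real^2)) set \<Rightarrow> real \<Rightarrow> (real^2) set" where
  "slice D \<alpha> = {x. (\<alpha>, x) \<in> D}"

definition C1_on :: "('a::real_normed_vector) set \<Rightarrow> ('a \<Rightarrow> 'b::real_normed_vector) \<Rightarrow> bool" where
  "C1_on D f \<longleftrightarrow> (\<exists>f' :: 'a \<Rightarrow> 'a \<Rightarrow>\<^sub>L 'b.
     (\<forall>p\<in>D. (f has_derivative blinfun_apply (f' p)) (at p)) \<and> continuous_on D f')"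

text \<open>
  The gradient of \<open>\<phi>\<^sub>\<alpha>\<close> at \<open>x\<close>, where \<open>p = (\<alpha>, x)\<close>; the description is meaningful
  wherever \<open>\<phi>\<^sub>\<alpha>\<close> is differentiable.
\<close>

definition grad_x :: "(real \<times> (real^2) \<Rightarrow> real) \<Rightarrow> real \<times> (real^2) \<Rightarrow> real^2" where
  "grad_x \<phi> p = (THE g. GDERIV (\<lambda>x. \<phi> (fst p, x)) (snd p) :> g)"

definition nonstationary :: "(real \<times> (real^2)) set \<Rightarrow> (real \<times> (real^2) \<Rightarrow> real) \<Rightarrow> bool" where
  "nonstationary D \<phi> \<longleftrightarrow> (\<forall>p\<in>D. grad_x \<phi> p \<noteq> 0)"

text \<open>
  An element of \<open>\<real>/\<pi>\<int>\<close> is represented as a coset, the set of all its real representatives.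
  For nonzero \<open>v\<close>, the unoriented direction perpendicular to \<open>v\<close> is the coset of all \<open>t\<close> such that
  \<open>(cos t, sin t)\<close> is perpendicular to \<open>v\<close>.
\<close>

definition perp_direction :: "real^2 \<Rightarrow> real set" where
  "perp_direction v = {t. orthogonal (vector [cos t, sin t]) v}"

definition tangent_direction :: "(real \<times> (real^2) \<Rightarrow> real) \<Rightarrow> real \<Rightarrow> real^2 \<Rightarrow> real set" where
  "tangent_direction \<phi> \<alpha> x = perp_direction (grad_x \<phi> (\<alpha>, x))"

text \<open>
  Below, \<open>\<theta> \<alpha>\<close> is the unique representative of the tangent direction at \<open>x\<close> in \<open>[a, a + \<pi>)\<close>;
  \<open>a\<close> may depend on \<open>x\<close>.
\<close>

definition angle_monotone :: "(real \<times> (real^2)) set \<Rightarrow> (real \<times> (real^2) \<Rightarrow> real) \<Rightarrow> bool" where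
  "angle_monotone D \<phi> \<longleftrightarrow> (\<forall>x. \<exists>a::real. \<exists>\<theta>::real \<Rightarrow> real.
     (\<forall>\<alpha>. (\<alpha>, x) \<in> D \<longrightarrow> \<theta> \<alpha> \<in> tangent_direction \<phi> \<alpha> x \<inter> {a..<a + pi}) \<and>
     strict_mono_on {\<alpha>. (\<alpha>, x) \<in> D} \<theta>)"

end

theory Submission
  imports Defs
begin

text \<open>
  A point \<open>x\<close> is regarded as the curve \<open>{(\<alpha>, \<phi> (\<alpha>, x))}\<close> in the \<open>(\<alpha>, t)\<close>-plane; one has to cover the
  set with slices \<open>F \<alpha>\<close> by such curves without increasing its measure. Locally this is a
  Venetian blind: near a point \<open>(\<alpha>\<^sub>0, x\<^sub>0)\<close> angle monotonicity gives vectors \<open>e1\<close>, \<open>e\<close> such that for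
  \<open>\<alpha>\<close> close to \<open>\<alpha>\<^sub>0\<close> the function \<open>\<phi>\<^sub>\<alpha>\<close> increases in all directions \<open>e1 + s e\<close>, \<open>0 \<le> s \<le> 1\<close>, whereas
  for \<open>\<alpha>\<close> away from \<open>\<alpha>\<^sub>0\<close> its derivative vanishes in one of these directions. A union of tiny segments
  whose direction at the scale \<open>\<delta> / n ^ j\<close> is \<open>e1 + (Suc j / n) e\<close> then has full image under \<open>\<phi>\<^sub>\<alpha>\<close> in
  the first case (only downward jumps occur, so an intermediate value theorem holds) and image of
  measure \<open>O(1 / n)\<close> in the second. Iterating this with open supersets of the given set whose excess
  measure tends to \<open>0\<close>, and arranging the pieces in a tree with nested compact sets along each branch, yields
  \<open>E\<close> as a countable intersection of open sets; Fubini's theorem concludes.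
\<close>

subsection \<open>Sawtooth functions\<close>

text \<open>
  The average of the functions \<open>\<tau> mod (\<delta> / n ^ i)\<close>, \<open>i < n\<close>.
\<close>

definition sawtooth :: "real \<Rightarrow> nat \<Rightarrow> real \<Rightarrow> real" where
  "sawtooth \<delta> n \<tau> = (\<Sum>i<n. \<tau> - \<delta> / real n ^ i * \<lfloor>\<tau> / (\<delta> / real n ^ i)\<rfloor>) / real n"

lemma mult_floor_divide_bounds:
  fixes d \<tau> :: real
  assumes "d > 0"
  shows "0 \<le> \<tau> - d * \<lfloor>\<tau> / d\<rfloor>" "\<tau> - d * \<lfloor>\<tau> / d\<rfloor> < d"
  using floor_divide_lower[OF assms, of \<tau>] floor_divide_upper[OF assms, of \<tau>]
  by (auto simp: algebra_simps)

lemma sawtooth_bounds: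
  assumes "\<delta> > 0" "n > 0"
  shows "0 \<le> sawtooth \<delta> n \<tau>" "sawtooth \<delta> n \<tau> \<le> \<delta>"
proof -
  have d: "\<delta> / real n ^ i > 0" "\<delta> / real n ^ i \<le> \<delta>" for i
    using assms by (auto simp: divide_le_eq)
  show "0 \<le> sawtooth \<delta> n \<tau>"
    unfolding sawtooth_def
    by (intro divide_nonneg_nonneg sum_nonneg mult_floor_divide_bounds(1) d) auto
  have "(\<Sum>i<n. \<tau> - \<delta> / real n ^ i * \<lfloor>\<tau> / (\<delta> / real n ^ i)\<rfloor>) \<le> (\<Sum>i<n. \<delta>)"
    using mult_floor_divide_bounds(2)[OF d(1), of \<tau>] d(2)
    by (intro sum_mono) (meson less_eq_real_def order_less_le_trans)
  then show "sawtooth \<delta> n \<tau> \<le> \<delta>"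
    using assms by (simp add: sawtooth_def divide_le_eq mult.commute)
qed

lemma sawtooth_0 [simp]: "sawtooth \<delta> n 0 = 0"
  by (simp add: sawtooth_def)

text \<open>Each summand has slope 1 between its jumps, and all jumps go down, so the average never
  grows faster than the identity.\<close>

lemma sawtooth_diff_le:
  assumes "\<delta> > 0" "n > 0" "a \<le> b"
  shows "sawtooth \<delta> n b - sawtooth \<delta> n a \<le> b - a"
proof -
  have d: "\<delta> / real n ^ i > 0" for i
    using assms by auto
  have *: "(b - \<delta> / real n ^ i * \<lfloor>b / (\<delta> / real n ^ i)\<rfloor>) - (a - \<delta> / real n ^ i * \<lfloor>a / (\<delta> / real n ^ i)\<rfloor>) \<le> b - a" for i
  proof -
    have "\<lfloor>a / (\<delta> / real n ^ i)\<rfloor> \<le> \<lfloor>b / (\<delta> / real n ^ i)\<rfloor>"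
      by (intro floor_mono divide_right_mono) (use assms d[of i] in auto)
    then have "\<delta> / real n ^ i * \<lfloor>a / (\<delta> / real n ^ i)\<rfloor> \<le> \<delta> / real n ^ i * \<lfloor>b / (\<delta> / real n ^ i)\<rfloor>"
      using d[of i] by (intro mult_left_mono) auto
    then show ?thesis by linarith
  qed
  have "sawtooth \<delta> n b - sawtooth \<delta> n a =
    (\<Sum>i<n. (b - \<delta> / real n ^ i * \<lfloor>b / (\<delta> / real n ^ i)\<rfloor>) - (a - \<delta> / real n ^ i * \<lfloor>a / (\<delta> / real n ^ i)\<rfloor>)) / real n"
    by (simp only: sawtooth_def sum_subtractf diff_divide_distrib)
  also have "\<dots> \<le> (\<Sum>i<n. b - a) / real n"
    by (intro divide_right_mono sum_mono *) auto
  finally show ?thesis using assms by simp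
qed

lemma floor_tendsto_at_right: "((\<lambda>x. of_int \<lfloor>x\<rfloor> :: real) \<longlongrightarrow> of_int \<lfloor>a\<rfloor>) (at_right (a::real))"
proof -
  have "eventually (\<lambda>x. x \<in> {a<..<of_int \<lfloor>a\<rfloor> + 1}) (at_right a)"
    by (rule eventually_at_right_real) linarith
  then have "eventually (\<lambda>x. of_int \<lfloor>x\<rfloor> = (of_int \<lfloor>a\<rfloor> :: real)) (at_right a)"
    by eventually_elim (auto simp: floor_eq_iff, linarith)
  then show ?thesis
    by (simp add: tendsto_eventually)
qed

lemma sawtooth_right_continuous:
  assumes "\<delta> > 0" "n > 0"
  shows "(sawtooth \<delta> n \<longlongrightarrow> sawtooth \<delta> n a) (at_right a)"
proof -
  have *: "((\<lambda>x. of_int \<lfloor>x / d\<rfloor> :: real) \<longlongrightarrow> of_int \<lfloor>a / d\<rfloor>) (at_right a)" if "d > 0" for d :: real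
  proof (rule filterlim_compose[OF floor_tendsto_at_right])
    have "((\<lambda>x. x / d) \<longlongrightarrow> a / d) (at_right a)"
      using that by (intro tendsto_intros) auto
    moreover have "eventually (\<lambda>x. x / d > a / d) (at_right a)"
      using that by (auto simp: eventually_at_filter divide_strict_right_mono)
    ultimately show "filterlim (\<lambda>x. x / d) (at_right (a / d)) (at_right a)"
      by (auto simp: filterlim_at elim: eventually_mono)
  qed
  have "((\<lambda>x. of_int \<lfloor>x / (\<delta> / real n ^ i)\<rfloor> :: real) \<longlongrightarrow> of_int \<lfloor>a / (\<delta> / real n ^ i)\<rfloor>) (at_right a)" for i
    by (rule *) (use assms in auto)
  then show ?thesis
    unfolding sawtooth_def using assms(2) by (intro tendsto_intros) auto
qed

text \<open>Cells of length \<open>\<delta> / real n ^ j\<close> subdivide those of length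
  \<open>\<delta> / real n ^ i\<close>: the coarser index is the integer quotient of the finer one
  by \<open>n ^ (j - i)\<close>.\<close>

lemma floor_divide_eq_coarser:
  fixes \<tau> \<tau>' \<delta> :: real and n :: nat
  assumes "n > 0" "i \<le> j" and eq: "\<lfloor>\<tau> / (\<delta> / real n ^ j)\<rfloor> = \<lfloor>\<tau>' / (\<delta> / real n ^ j)\<rfloor>"
  shows "\<lfloor>\<tau> / (\<delta> / real n ^ i)\<rfloor> = \<lfloor>\<tau>' / (\<delta> / real n ^ i)\<rfloor>"
proof -
  have *: "\<lfloor>t / (\<delta> / real n ^ i)\<rfloor> = \<lfloor>t / (\<delta> / real n ^ j)\<rfloor> div int (n ^ (j - i))" for t :: real
  proof -
    have e: "t / (\<delta> / real n ^ i) = t / (\<delta> / real n ^ j) / real_of_int (int (n ^ (j - i)))"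
    proof -
      have "real n ^ j = real n ^ i * real n ^ (j - i)"
        using assms by (simp flip: power_add)
      then show ?thesis
        using assms(1) by simp
    qed
    show ?thesis
      unfolding e by (rule floor_divide_real_eq_div) simp
  qed
  show ?thesis unfolding * eq ..
qed

text \<open>Inside a cell of scale \<open>j\<close>, the \<open>j + 1\<close> summands with
  \<open>i \<le> j\<close> have no jump and together contribute the slope \<open>Suc j / n\<close>.
  Each finer summand oscillates by at most \<open>\<delta> / real n ^ Suc j\<close>, hence so does
  their share of the average.\<close>

lemma sawtooth_cell:
  assumes "\<delta> > 0" "n > 0" "j < n" and eq: "\<lfloor>\<tau> / (\<delta> / real n ^ j)\<rfloor> = \<lfloor>\<tau>' / (\<delta> / real n ^ j)\<rfloor>"
  shows "\<bar>sawtooth \<delta> n \<tau> - sawtooth \<delta> n \<tau>' - real (Suc j) / real n * (\<tau> - \<tau>')\<bar> \<le> \<delta> / real n ^ Suc j"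
proof -
  define u where "u i t = t - \<delta> / real n ^ i * \<lfloor>t / (\<delta> / real n ^ i)\<rfloor>" for i t
  have d: "\<delta> / real n ^ i > 0" for i
    using assms(1,2) by auto
  have split: "{..<n} = {..j} \<union> {Suc j..<n}" "{..j} \<inter> {Suc j..<n} = {}"
    using \<open>j < n\<close> by auto
  have "sawtooth \<delta> n \<tau> - sawtooth \<delta> n \<tau>' = (\<Sum>i<n. u i \<tau> - u i \<tau>') / real n"
    unfolding sawtooth_def u_def by (simp only: sum_subtractf diff_divide_distrib)
  also have "(\<Sum>i<n. u i \<tau> - u i \<tau>') = (\<Sum>i\<le>j. u i \<tau> - u i \<tau>') + (\<Sum>i\<in>{Suc j..<n}. u i \<tau> - u i \<tau>')"
    unfolding split(1) by (rule sum.union_disjoint) (auto simp: split)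
  also have "(\<Sum>i\<le>j. u i \<tau> - u i \<tau>') = (\<Sum>i\<le>j. \<tau> - \<tau>')"
  proof (intro sum.cong refl)
    fix i assume "i \<in> {..j}"
    then have "\<lfloor>\<tau> / (\<delta> / real n ^ i)\<rfloor> = \<lfloor>\<tau>' / (\<delta> / real n ^ i)\<rfloor>"
      by (intro floor_divide_eq_coarser[OF \<open>n > 0\<close> _ eq]) simp
    then show "u i \<tau> - u i \<tau>' = \<tau> - \<tau>'" by (simp add: u_def)
  qed
  finally have "sawtooth \<delta> n \<tau> - sawtooth \<delta> n \<tau>' - real (Suc j) / real n * (\<tau> - \<tau>')
      = (\<Sum>i\<in>{Suc j..<n}. u i \<tau> - u i \<tau>') / real n"
    by (simp only: add_divide_distrib sum_constant card_atMost times_divide_eq_left add_diff_cancel_left')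
  then have "\<bar>sawtooth \<delta> n \<tau> - sawtooth \<delta> n \<tau>' - real (Suc j) / real n * (\<tau> - \<tau>')\<bar>
      = \<bar>\<Sum>i\<in>{Suc j..<n}. u i \<tau> - u i \<tau>'\<bar> / n"
    by (simp only: abs_divide abs_of_nat)
  also have "\<dots> \<le> (\<Sum>i\<in>{Suc j..<n}. \<delta> / real n ^ Suc j) / real n"
  proof (intro divide_right_mono order_trans[OF sum_abs] sum_mono)
    fix i assume i: "i \<in> {Suc j..<n}"
    have "0 \<le> u i \<tau>" "u i \<tau> < \<delta> / real n ^ i" "0 \<le> u i \<tau>'" "u i \<tau>' < \<delta> / real n ^ i"
      unfolding u_def using mult_floor_divide_bounds[OF d] by blast+
    then have "\<bar>u i \<tau> - u i \<tau>'\<bar> \<le> \<delta> / real n ^ i" by linarith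
    also have "\<dots> \<le> \<delta> / real n ^ Suc j"
      using i assms(1,2) by (intro divide_left_mono power_increasing) auto
    finally show "\<bar>u i \<tau> - u i \<tau>'\<bar> \<le> \<delta> / real n ^ Suc j" .
  qed auto
  also have "\<dots> \<le> \<delta> / real n ^ Suc j"
  proof -
    have "(\<Sum>i\<in>{Suc j..<n}. \<delta> / real n ^ Suc j) \<le> real n * (\<delta> / real n ^ Suc j)"
      using d[of "Suc j"] unfolding sum_constant by (intro mult_right_mono) auto
    then show ?thesis
      using \<open>n > 0\<close> by (simp only: divide_le_eq of_nat_0_less_iff mult.commute if_True)
  qed
  finally show ?thesis .
qed

section \<open>Intermediate values in the presence of downward jumps\<close>

text \<open>Let \<open>s\<close> be the supremum of the points where \<open>f\<close> is at most
  \<open>t\<close>. The left condition forbids upward jumps, so \<open>f s > t\<close> would force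
  \<open>f > t\<close> just to the left of \<open>s\<close>; by right continuity,
  \<open>f s < t\<close> would put points beyond \<open>s\<close> into the set.\<close>

lemma IVT_downward_jumps:
  fixes f :: "real \<Rightarrow> real"
  assumes "a \<le> b" "f a \<le> t" "t \<le> f b"
    and right: "\<And>x. a \<le> x \<Longrightarrow> x < b \<Longrightarrow> (f \<longlongrightarrow> f x) (at_right x)"
    and left: "\<And>x e. a < x \<Longrightarrow> x \<le> b \<Longrightarrow> e > 0 \<Longrightarrow> eventually (\<lambda>y. f x < f y + e) (at_left x)"
  shows "\<exists>x\<in>{a..b}. f x = t"
proof -
  define S where "S = {x\<in>{a..b}. f x \<le> t}"
  define s where "s = Sup S"
  have S: "a \<in> S" "bdd_above S" "S \<subseteq> {a..b}"
    using assms by (auto simp: S_def)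
  have s: "a \<le> s" "s \<le> b"
    using S cSup_upper[of a S] unfolding s_def by (auto intro!: cSup_least)
  have "f s \<le> t"
  proof (rule ccontr)
    assume *: "\<not> f s \<le> t"
    then have "a < s" using s assms by (cases "a = s") auto
    then have "eventually (\<lambda>y. f s < f y + (f s - t)) (at_left s)"
      using left[of s "f s - t"] s * by auto
    then obtain c where c: "c < s" "\<And>y. c < y \<Longrightarrow> y < s \<Longrightarrow> t < f y"
      using \<open>a < s\<close> by (auto simp: eventually_at_left[of a])
    then obtain y where "y \<in> S" "c < y"
      using less_cSup_iff[of S c] S unfolding s_def by blast
    moreover have "y \<le> s" using \<open>y \<in> S\<close> S cSup_upper by (auto simp: s_def)
    ultimately show False using c(2)[of y] * by (cases "y = s") (auto simp: S_def)
  qed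
  moreover have "\<not> f s < t"
  proof
    assume *: "f s < t"
    then have "s < b" using s assms by (cases "s = b") auto
    have "eventually (\<lambda>y. f y < t) (at_right s)"
      using order_tendstoD(2)[OF right *] s \<open>s < b\<close> by auto
    then obtain c where c: "c > s" "\<And>y. s < y \<Longrightarrow> y < c \<Longrightarrow> f y < t"
      using \<open>s < b\<close> by (auto simp: eventually_at_right[of s b])
    define y where "y = min ((s + c) / 2) b"
    have y: "s < y" "y < c" "y \<le> b" using c \<open>s < b\<close> by (auto simp: y_def min_def)
    then have "y \<in> S" using c s by (auto simp: S_def intro: less_imp_le)
    then show False using cSup_upper[of y S] S y by (auto simp: s_def)
  qed
  ultimately show ?thesis using s by auto
qed

subsection \<open>Directions in the plane\<close>

definition det2 :: "real^2 \<Rightarrow> real^2 \<Rightarrow> real" where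
  "det2 u v = u $ 1 * v $ 2 - u $ 2 * v $ 1"

lemma det2_swap: "det2 v u = - det2 u v"
  by (simp add: det2_def)

lemma inner_real2: "u \<bullet> v = u $ 1 * v $ 1 + u $ 2 * v $ 2" for u v :: "real^2"
  by (simp add: inner_vec_def sum_2)

text \<open>Cramer's rule with denominators cleared.\<close>

lemma det2_expand: "det2 u v *\<^sub>R g = det2 g v *\<^sub>R u + det2 u g *\<^sub>R v"
  by (simp add: vec_eq_iff forall_2 det2_def algebra_simps)

text \<open>Cramer's rule for the linear system with rows \<open>u\<close> and \<open>v\<close>. It
  allows a direction to be chosen through its inner products with two gradients.\<close>

lemma ex_inner_prescribed:
  assumes "det2 u v \<noteq> 0"
  shows "\<exists>e. u \<bullet> e = a \<and> v \<bullet> e = b"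
proof -
  define d where "d = det2 u v"
  let ?e = "vector [(a * v $ 2 - b * u $ 2) / d, (b * u $ 1 - a * v $ 1) / d] :: real^2"
  have d: "d \<noteq> 0" "d = u $ 1 * v $ 2 - u $ 2 * v $ 1"
    using assms by (auto simp: d_def det2_def)
  have "u \<bullet> ?e = (u $ 1 * (a * v $ 2 - b * u $ 2) + u $ 2 * (b * u $ 1 - a * v $ 1)) / d"
    by (simp add: inner_real2 add_divide_distrib)
  also have "\<dots> = a * d / d"
    by (rule arg_cong[where f = "\<lambda>t. t / d"]) (simp add: d(2) algebra_simps)
  finally have 1: "u \<bullet> ?e = a" using d(1) by simp
  have "v \<bullet> ?e = (v $ 1 * (a * v $ 2 - b * u $ 2) + v $ 2 * (b * u $ 1 - a * v $ 1)) / d"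
    by (simp add: inner_real2 add_divide_distrib)
  also have "\<dots> = b * d / d"
    by (rule arg_cong[where f = "\<lambda>t. t / d"]) (simp add: d(2) algebra_simps)
  finally have 2: "v \<bullet> ?e = b" using d(1) by simp
  from 1 2 show ?thesis by blast
qed

text \<open>
  The lines orthogonal to \<open>e1\<close> and \<open>e1 + e\<close> separate \<open>\<plusminus> g\<close> from the double cone spanned by \<open>s1 g1\<close> and
  \<open>s5 g5\<close>. The conditions on \<open>g1\<close> and \<open>g5\<close> are open, so they survive small perturbations.
\<close>

lemma separating_directions:
  assumes pos: "det2 g1 g * det2 g g5 * det2 g1 g5 > 0"
  obtains e1 e s1 s5 where
    "g \<bullet> e1 > 0" "g \<bullet> e > 0" "s1 * s5 * det2 g5 g1 > 0"
    "s1 * (g1 \<bullet> e1) > 0" "s1 * (g1 \<bullet> (e1 + e)) < 0"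
    "s5 * (g5 \<bullet> e1) > 0" "s5 * (g5 \<bullet> (e1 + e)) < 0"
proof -
  define d where "d = det2 g1 g5"
  \<comment> \<open>\<open>p\<close> and \<open>q\<close> are the coordinates of \<open>g\<close> in
    the basis \<open>g1\<close>, \<open>g5\<close>.\<close>
  define p where "p = det2 g g5 / d"
  define q where "q = det2 g1 g / d"
  have d0: "d \<noteq> 0" using pos by (auto simp: d_def)
  have pqd: "p * q * d > 0"
  proof -
    have "p * q * d = (det2 g1 g * det2 g g5 * det2 g1 g5) / d\<^sup>2"
      using d0 by (simp add: p_def q_def d_def power2_eq_square)
    then show ?thesis using pos d0 by simp
  qed
  then have p0: "p \<noteq> 0" and q0: "q \<noteq> 0" by auto
  have "g = (1 / d) *\<^sub>R (d *\<^sub>R g)" using d0 by simp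
  also have "\<dots> = p *\<^sub>R g1 + q *\<^sub>R g5"
    unfolding d_def det2_expand[of g1 g5 g]
    by (simp add: p_def q_def d_def scaleR_add_right divide_inverse_commute)
  finally have g: "g \<bullet> e = p * (g1 \<bullet> e) + q * (g5 \<bullet> e)" for e
    by (simp add: inner_add_left)
  \<comment> \<open>A positive number below both |q| / |p| and |p| / |q|: dropping one of the
    squares from the denominator gives either bound.\<close>
  define \<eta> where "\<eta> = \<bar>p\<bar> * \<bar>q\<bar> / (p\<^sup>2 + q\<^sup>2)"
  have pq: "p\<^sup>2 > 0" "q\<^sup>2 > 0" using p0 q0 by auto
  have \<eta>: "\<eta> > 0" "\<eta> * \<bar>p\<bar> < \<bar>q\<bar>" "\<eta> * \<bar>q\<bar> < \<bar>p\<bar>"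
  proof -
    have "\<bar>p\<bar> * \<bar>q\<bar> > 0" using p0 q0 by simp
    moreover have sum: "p\<^sup>2 + q\<^sup>2 > 0" using pq by linarith
    ultimately show "\<eta> > 0" unfolding \<eta>_def by (rule divide_pos_pos)
    have "\<eta> * \<bar>p\<bar> = \<bar>q\<bar> * (p\<^sup>2 / (p\<^sup>2 + q\<^sup>2))"
      by (simp add: \<eta>_def power2_eq_square abs_mult_self_eq)
    also have "\<dots> < \<bar>q\<bar> * 1"
      using pq q0 by (intro mult_strict_left_mono) (auto simp: pos_divide_less_eq[OF sum])
    finally show "\<eta> * \<bar>p\<bar> < \<bar>q\<bar>" by simp
    have "\<eta> * \<bar>q\<bar> = \<bar>p\<bar> * (q\<^sup>2 / (p\<^sup>2 + q\<^sup>2))"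
      by (simp add: \<eta>_def power2_eq_square abs_mult_self_eq)
    also have "\<dots> < \<bar>p\<bar> * 1"
      using pq p0 by (intro mult_strict_left_mono) (auto simp: pos_divide_less_eq[OF sum])
    finally show "\<eta> * \<bar>q\<bar> < \<bar>p\<bar>" by simp
  qed
  \<comment> \<open>With these signs, \<open>g\<close> is |q| times \<open>s5 g5\<close> minus |p|
    times \<open>s1 g1\<close>, so its coefficients on the generators of the cone have opposite
    signs.\<close>
  define s1 where "s1 = - sgn p"
  define s5 where "s5 = sgn q"
  have s: "\<bar>s1\<bar> = 1" "\<bar>s5\<bar> = 1" "s1 * s1 = 1" "s5 * s5 = 1"
    using p0 q0 by (auto simp: s1_def s5_def sgn_if)
  \<comment> \<open>\<open>e1\<close> is positive and \<open>e3\<close> negative on both generators.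
    The small value \<eta> is placed so that \<open>g\<close> is positive on both vectors: its
    products with them are |q| - \<eta>|p| and |p| - \<eta>|q|.\<close>
  obtain e1 where e1: "g1 \<bullet> e1 = s1 * \<eta>" "g5 \<bullet> e1 = s5"
    using ex_inner_prescribed[of g1 g5] d0 unfolding d_def by blast
  obtain e3 where e3: "g1 \<bullet> e3 = - s1" "g5 \<bullet> e3 = - s5 * \<eta>"
    using ex_inner_prescribed[of g1 g5] d0 unfolding d_def by blast
  have ge1: "g \<bullet> e1 > 0"
  proof -
    have "g \<bullet> e1 = - (\<eta> * \<bar>p\<bar>) + \<bar>q\<bar>"
      unfolding g e1 by (simp add: s1_def s5_def abs_sgn algebra_simps)
    then show ?thesis using \<eta> by simp
  qed
  have ge3: "g \<bullet> e3 > 0"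
  proof -
    have "g \<bullet> e3 = \<bar>p\<bar> - \<eta> * \<bar>q\<bar>"
      unfolding g e3 by (simp add: s1_def s5_def abs_sgn algebra_simps)
    then show ?thesis using \<eta> by simp
  qed
  \<comment> \<open>\<open>e3\<close> becomes the sum \<open>e1 + e\<close> of the conclusion. After
    scaling by \<kappa>, the product of \<open>g\<close> with \<open>e1\<close> is half of that with
    \<open>e3\<close>, so the difference \<open>e\<close> is also positive on
    \<open>g\<close>.\<close>
  define \<kappa> where "\<kappa> = (g \<bullet> e3) / (2 * (g \<bullet> e1))"
  have \<kappa>: "\<kappa> > 0" using ge1 ge3 by (simp add: \<kappa>_def)
  show ?thesis
  proof (rule that[of "\<kappa> *\<^sub>R e1" "e3 - \<kappa> *\<^sub>R e1" s1 s5])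
    show "g \<bullet> \<kappa> *\<^sub>R e1 > 0" using \<kappa> ge1 by simp
    have "\<kappa> * (g \<bullet> e1) = (g \<bullet> e3) / 2" using ge1 by (simp add: \<kappa>_def)
    then show "g \<bullet> (e3 - \<kappa> *\<^sub>R e1) > 0" using ge3 by (simp add: inner_diff_right)
    show "s1 * s5 * det2 g5 g1 > 0"
    proof -
      have "s1 * s5 * det2 g5 g1 = sgn (p * q) * d"
        by (simp add: s1_def s5_def det2_swap[of g5 g1] d_def sgn_mult)
      moreover have "sgn x * d > 0" if "x * d > 0" for x
        using that by (auto simp: sgn_if zero_less_mult_iff)
      ultimately show ?thesis using pqd by simp
    qed
    have s': "s1 * (s1 * t) = t" "s5 * (s5 * t) = t" for t
      using s by (simp_all flip: mult.assoc)
    show "s1 * (g1 \<bullet> \<kappa> *\<^sub>R e1) > 0" "s5 * (g5 \<bullet> \<kappa> *\<^sub>R e1) > 0"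
      using \<kappa> \<eta>(1) s by (simp_all add: e1 mult.left_commute[of _ \<kappa>] s')
    show "s1 * (g1 \<bullet> (\<kappa> *\<^sub>R e1 + (e3 - \<kappa> *\<^sub>R e1))) < 0"
      "s5 * (g5 \<bullet> (\<kappa> *\<^sub>R e1 + (e3 - \<kappa> *\<^sub>R e1))) < 0"
      using \<eta>(1) s by (simp_all add: e3 s')
  qed
qed

text \<open>Expanding \<open>g\<close> in \<open>g5\<close>, \<open>g1\<close> gives coefficients
  \<open>A\<close>, \<open>B\<close> on the signed generators, and the last hypothesis makes
  \<open>A * B\<close> nonnegative. Since both generators are positive on \<open>e\<close> and
  negative on \<open>e'\<close>, the product of the two expansions has only nonpositive
  terms.\<close>

lemma cone_sign:
  assumes s: "s1 * s5 * det2 g5 g1 > 0"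
    and e: "s1 * (g1 \<bullet> e) > 0" "s1 * (g1 \<bullet> e') < 0" "s5 * (g5 \<bullet> e) > 0" "s5 * (g5 \<bullet> e') < 0"
    and g: "det2 g5 g1 * det2 g g1 * det2 g5 g > 0"
  shows "(g \<bullet> e) * (g \<bullet> e') \<le> 0"
proof -
  define k where "k = s1 * s5 * det2 g5 g1"
  define A where "A = s1 * det2 g g1"
  define B where "B = s5 * det2 g5 g"
  define X where "X f = s5 * (g5 \<bullet> f)" for f
  define Y where "Y f = s1 * (g1 \<bullet> f)" for f
  have k: "k > 0" using s by (simp add: k_def)
  have ex: "k * (g \<bullet> f) = A * X f + B * Y f" for f
  proof -
    have "det2 g5 g1 * (g \<bullet> f) = det2 g g1 * (g5 \<bullet> f) + det2 g5 g * (g1 \<bullet> f)"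
      using arg_cong[OF det2_expand[of g5 g1 g], of "\<lambda>v. v \<bullet> f"] by (simp add: inner_add_left)
    then have "s1 * s5 * (det2 g5 g1 * (g \<bullet> f))
        = s1 * s5 * (det2 g g1 * (g5 \<bullet> f) + det2 g5 g * (g1 \<bullet> f))" by (rule arg_cong)
    then show ?thesis by (simp only: k_def A_def B_def X_def Y_def algebra_simps)
  qed
  have AB: "A * B \<ge> 0"
  proof -
    have "k * (det2 g5 g1 * det2 g g1 * det2 g5 g) > 0" using k g by (rule mult_pos_pos)
    then have "(det2 g5 g1)\<^sup>2 * (A * B) > 0"
      by (simp add: k_def A_def B_def power2_eq_square mult_ac)
    then show ?thesis by (metis less_eq_real_def zero_less_mult_pos zero_le_power2 mult_eq_0_iff less_irrefl)
  qed
  have XY: "X e > 0" "Y e > 0" "X e' < 0" "Y e' < 0" using e by (simp_all add: X_def Y_def)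
  have "(k * (g \<bullet> e)) * (k * (g \<bullet> e'))
      = A\<^sup>2 * (X e * X e') + A * B * (X e * Y e' + Y e * X e') + B\<^sup>2 * (Y e * Y e')"
    unfolding ex by (simp add: power2_eq_square algebra_simps)
  also have "\<dots> \<le> 0"
    using XY AB
    by (intro add_nonpos_nonpos mult_nonneg_nonpos mult_nonneg_nonpos[of "X e"] mult_nonneg_nonpos[of "Y e"]) auto
  finally have "k\<^sup>2 * ((g \<bullet> e) * (g \<bullet> e')) \<le> 0" by (simp add: power2_eq_square mult_ac)
  moreover have "k\<^sup>2 > 0" using k by simp
  ultimately show ?thesis by (simp add: mult_le_0_iff)
qed

subsection \<open>Phase functions\<close>

locale phase_function =
  fixes D :: "(real \<times> (real^2)) set"
    and \<phi> :: "real \<times> (real^2) \<Rightarrow> real"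
    and G :: "real \<times> (real^2) \<Rightarrow> real^2"
  assumes open_D: "open D"
    and grad: "(\<alpha>, x) \<in> D \<Longrightarrow> ((\<lambda>y. \<phi> (\<alpha>, y)) has_derivative (\<lambda>v. G (\<alpha>, x) \<bullet> v)) (at x)"
    and cont_\<phi>: "continuous_on D \<phi>"
    and cont_G: "continuous_on (closure D) G"
    and G_nonzero: "(\<alpha>, x) \<in> D \<Longrightarrow> G (\<alpha>, x) \<noteq> 0"
    \<comment> \<open>Angle monotonicity, in a form that does not depend on the choice of signs of the gradients.\<close>
    and det2_G: "(\<alpha>, x) \<in> D \<Longrightarrow> (\<beta>, x) \<in> D \<Longrightarrow> (\<gamma>, x) \<in> D \<Longrightarrow> \<alpha> < \<beta> \<Longrightarrow> \<beta> < \<gamma> \<Longrightarrow>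
      det2 (G (\<alpha>, x)) (G (\<beta>, x)) * det2 (G (\<beta>, x)) (G (\<gamma>, x)) * det2 (G (\<alpha>, x)) (G (\<gamma>, x)) > 0"
    and convex_slice: "convex (slice D \<alpha>)"
begin

lemma open_box:
  assumes "(\<alpha>, x) \<in> D"
  obtains r where "r > 0" "\<And>\<alpha>' x'. \<bar>\<alpha>' - \<alpha>\<bar> < r \<Longrightarrow> dist x' x < r \<Longrightarrow> (\<alpha>', x') \<in> D"
proof -
  obtain A B where AB: "open A" "open B" "(\<alpha>, x) \<in> A \<times> B" "A \<times> B \<subseteq> D"
    using open_prod_elim[OF open_D assms] by metis
  obtain r1 where r1: "r1 > 0" "\<And>y. dist y \<alpha> < r1 \<Longrightarrow> y \<in> A"
    using AB unfolding open_dist by fastforce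
  obtain r2 where r2: "r2 > 0" "\<And>y. dist y x < r2 \<Longrightarrow> y \<in> B"
    using AB unfolding open_dist by fastforce
  show ?thesis
    using r1 r2 AB(4) by (intro that[of "min r1 r2"]) (auto simp: dist_real_def)
qed

lemma isCont_\<phi>: "p \<in> D \<Longrightarrow> isCont \<phi> p"
  using cont_\<phi> open_D by (simp add: continuous_on_eq_continuous_at)

lemma isCont_G: "p \<in> D \<Longrightarrow> isCont G p"
  using continuous_on_subset[OF cont_G closure_subset] open_D
  by (simp add: continuous_on_eq_continuous_at)

text \<open>Convexity of the slice keeps the segment inside \<open>D\<close>, so the one-variable
  mean value theorem applies along it.\<close>

lemma slice_mvt:
  assumes "(\<alpha>, x) \<in> D" "(\<alpha>, y) \<in> D"
  obtains z where "z \<in> closed_segment x y" "(\<alpha>, z) \<in> D"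
    "\<phi> (\<alpha>, y) - \<phi> (\<alpha>, x) = G (\<alpha>, z) \<bullet> (y - x)"
proof -
  let ?l = "\<lambda>t. x + t *\<^sub>R (y - x)"
  have l: "?l t \<in> closed_segment x y" if "0 \<le> t" "t \<le> 1" for t
    unfolding closed_segment_def using that by (auto simp: algebra_simps intro!: exI[of _ t])
  have "closed_segment x y \<subseteq> slice D \<alpha>"
    using convex_slice assms by (intro closed_segment_subset) (auto simp: slice_def)
  then have inD: "(\<alpha>, ?l t) \<in> D" if "0 \<le> t" "t \<le> 1" for t
    using l[OF that] by (auto simp: slice_def)
  have "DERIV (\<lambda>t. \<phi> (\<alpha>, ?l t)) t :> G (\<alpha>, ?l t) \<bullet> (y - x)" if "0 \<le> t" "t \<le> 1" for t
  proof -
    have "((\<lambda>t. ?l t) has_derivative (\<lambda>s. s *\<^sub>R (y - x))) (at t)"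
      by (auto intro!: derivative_eq_intros)
    from diff_chain_at[OF this grad[OF inD[OF that]]] show ?thesis
      by (simp add: has_field_derivative_def o_def mult_commute_abs)
  qed
  from MVT2[OF zero_less_one this] obtain t where "0 < t" "t < 1"
    "\<phi> (\<alpha>, ?l 1) - \<phi> (\<alpha>, ?l 0) = (1 - 0) * (G (\<alpha>, ?l t) \<bullet> (y - x))" by blast
  then show ?thesis
    using l[of t] inD[of t] by (intro that[of "?l t"]) auto
qed

text \<open>By continuity in \<alpha>, a fixed pair \<open>p\<close>, \<open>q\<close> brackets all
  targets near \<open>(\<alpha>, t)\<close>, not just \<open>t\<close> itself.\<close>

lemma between_stable:
  assumes "(\<alpha>, p) \<in> D" "(\<alpha>, q) \<in> D" "\<phi> (\<alpha>, p) < t" "t < \<phi> (\<alpha>, q)"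
  obtains s where "s > 0" "\<And>\<alpha>' t'. \<bar>\<alpha>' - \<alpha>\<bar> < s \<Longrightarrow> \<bar>t' - t\<bar> < s \<Longrightarrow> \<phi> (\<alpha>', p) < t' \<and> t' < \<phi> (\<alpha>', q)"
proof -
  have tends: "((\<lambda>\<alpha>'. \<phi> (\<alpha>', z)) \<longlongrightarrow> \<phi> (\<alpha>, z)) (nhds \<alpha>)" if "(\<alpha>, z) \<in> D" for z
  proof -
    have "isCont (\<lambda>\<alpha>'. \<phi> (\<alpha>', z)) \<alpha>"
      by (rule isCont_o2[where g = \<phi>]) (use isCont_\<phi>[OF that] in \<open>auto intro!: continuous_intros\<close>)
    then show ?thesis
      using tendsto_at_iff_tendsto_nhds[of "\<lambda>\<alpha>'. \<phi> (\<alpha>', z)" \<alpha>] by (simp add: isCont_def)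
  qed
  obtain u v where uv: "\<phi> (\<alpha>, p) < u" "u < t" "t < v" "v < \<phi> (\<alpha>, q)"
    using dense[OF assms(3)] dense[OF assms(4)] by blast
  have "\<forall>\<^sub>F \<alpha>' in nhds \<alpha>. \<phi> (\<alpha>', p) < u \<and> v < \<phi> (\<alpha>', q)"
    using order_tendstoD(2)[OF tends[OF assms(1)] uv(1)] order_tendstoD(1)[OF tends[OF assms(2)] uv(4)]
    by eventually_elim auto
  then obtain d where d: "d > 0" "\<And>\<alpha>'. dist \<alpha>' \<alpha> < d \<Longrightarrow> \<phi> (\<alpha>', p) < u \<and> v < \<phi> (\<alpha>', q)"
    unfolding eventually_nhds_metric by blast
  show ?thesis
  proof (rule that[of "min d (min (t - u) (v - t))"])
    fix \<alpha>' t'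
    assume *: "\<bar>\<alpha>' - \<alpha>\<bar> < min d (min (t - u) (v - t))" "\<bar>t' - t\<bar> < min d (min (t - u) (v - t))"
    then have "u < t'" "t' < v" by auto
    with d(2)[of \<alpha>'] * show "\<phi> (\<alpha>', p) < t' \<and> t' < \<phi> (\<alpha>', q)"
      by (auto simp: dist_real_def)
  qed (use d uv in auto)
qed

section \<open>Unions of the curves attached to the points of a set\<close>

definition curves :: "(real^2) set \<Rightarrow> (real \<times> real) set" where
  "curves W = {(\<alpha>, \<phi> (\<alpha>, x)) |\<alpha> x. (\<alpha>, x) \<in> D \<and> x \<in> W}"

lemma curves_mono: "V \<subseteq> W \<Longrightarrow> curves V \<subseteq> curves W"
  by (auto simp: curves_def)

lemma curves_UN: "curves (\<Union>i\<in>I. W i) = (\<Union>i\<in>I. curves (W i))"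
  by (auto simp: curves_def)

text \<open>Moving from \<open>x\<close> along plus or minus the gradient changes \<phi> strictly up
  or down. For nearby parameters the values at the two ends still bracket nearby targets, and the
  connected segment between them attains these. Openness makes the sets measured later
  Borel.\<close>

lemma open_curves:
  assumes "open W"
  shows "open (curves W)"
proof (rule openI)
  fix z assume "z \<in> curves W"
  then obtain \<alpha> x where z: "z = (\<alpha>, \<phi> (\<alpha>, x))" "(\<alpha>, x) \<in> D" "x \<in> W"
    by (auto simp: curves_def)
  obtain r where r: "r > 0" "\<And>\<alpha>' x'. \<bar>\<alpha>' - \<alpha>\<bar> < r \<Longrightarrow> dist x' x < r \<Longrightarrow> (\<alpha>', x') \<in> D"
    using open_box[OF z(2)] by metis
  obtain w where w: "w > 0" "ball x w \<subseteq> W"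
    using assms z(3) by (auto simp: open_contains_ball)
  define v where "v = G (\<alpha>, x)"
  define f where "f s = \<phi> (\<alpha>, x + s *\<^sub>R v)" for s
  have v: "v \<noteq> 0" using G_nonzero[OF z(2)] by (simp add: v_def)
  have "((\<lambda>s. x + s *\<^sub>R v) has_derivative (\<lambda>s. s *\<^sub>R v)) (at 0)"
    by (auto intro!: derivative_eq_intros)
  moreover have "((\<lambda>y. \<phi> (\<alpha>, y)) has_derivative (\<lambda>u. v \<bullet> u)) (at (x + 0 *\<^sub>R v))"
    using grad[OF z(2)] by (simp add: v_def)
  ultimately have "((\<lambda>y. \<phi> (\<alpha>, y)) \<circ> (\<lambda>s. x + s *\<^sub>R v) has_derivative ((\<lambda>u. v \<bullet> u) \<circ> (\<lambda>s. s *\<^sub>R v))) (at 0)"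
    by (rule diff_chain_at)
  then have "DERIV f 0 :> v \<bullet> v"
    by (simp add: has_field_derivative_def f_def[abs_def] o_def mult_commute_abs)
  moreover have "v \<bullet> v > 0" using v by simp
  ultimately obtain d1 d2 where d: "d1 > 0" "\<And>h. 0 < h \<Longrightarrow> h < d1 \<Longrightarrow> f 0 < f (0 + h)"
      "d2 > 0" "\<And>h. 0 < h \<Longrightarrow> h < d2 \<Longrightarrow> f (0 - h) < f 0"
    using DERIV_pos_inc_right[of f "v \<bullet> v" 0] DERIV_pos_inc_left[of f "v \<bullet> v" 0] by blast
  define k where "k = min r w / norm v"
  define h where "h = min (min d1 d2) k / 2"
  have h: "h > 0" "h < d1" "h < d2" "h * norm v < min r w"
  proof -
    have pos: "k > 0" using r w v by (simp add: k_def)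
    show "h > 0" "h < d1" "h < d2"
      using d(1,3) pos by (auto simp: h_def)
    have "h < k"
      using d(1,3) pos by (auto simp: h_def)
    then have "h < min r w / norm v" by (simp add: k_def)
    then show "h * norm v < min r w" using v by (simp add: pos_less_divide_eq)
  qed
  define p q where "p = x - h *\<^sub>R v" "q = x + h *\<^sub>R v"
  have pq: "dist p x < min r w" "dist q x < min r w"
    using h by (auto simp: p_q_def dist_norm)
  have D: "(\<alpha>, p) \<in> D" "(\<alpha>, q) \<in> D" using r pq by auto
  have "\<phi> (\<alpha>, p) < \<phi> (\<alpha>, x)" "\<phi> (\<alpha>, x) < \<phi> (\<alpha>, q)"
    using d(2)[of h] d(4)[of h] h by (auto simp: f_def p_q_def)
  then obtain s where s: "s > 0" "\<And>\<alpha>' t'. \<bar>\<alpha>' - \<alpha>\<bar> < s \<Longrightarrow> \<bar>t' - \<phi> (\<alpha>, x)\<bar> < s \<Longrightarrow> \<phi> (\<alpha>', p) < t' \<and> t' < \<phi> (\<alpha>', q)"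
    using between_stable[OF D] by metis
  show "\<exists>e>0. ball z e \<subseteq> curves W"
  proof (intro exI[of _ "min s r"] conjI subsetI)
    fix y assume y: "y \<in> ball z (min s r)"
    obtain \<alpha>' t' where y': "y = (\<alpha>', t')" by (cases y)
    have *: "\<bar>\<alpha>' - \<alpha>\<bar> < min s r" "\<bar>t' - \<phi> (\<alpha>, x)\<bar> < min s r"
      using y dist_fst_le[of z y] dist_snd_le[of z y] by (auto simp: y' z(1) dist_real_def)
    have "connected (closed_segment p q)" by simp
    moreover have seg: "closed_segment p q \<subseteq> ball x (min r w)"
      using pq by (intro closed_segment_subset) (auto simp: dist_commute)
    then have D': "(\<alpha>', u) \<in> D" if "u \<in> closed_segment p q" for u
      using that * by (intro r) (auto simp: dist_commute)
    have "continuous_on (closed_segment p q) (\<lambda>u. \<phi> (\<alpha>', u))"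
      by (rule continuous_on_compose2[OF cont_\<phi>]) (auto intro!: continuous_intros D')
    ultimately have "connected ((\<lambda>u. \<phi> (\<alpha>', u)) ` closed_segment p q)"
      by (intro connected_continuous_image)
    moreover have "\<phi> (\<alpha>', p) \<in> (\<lambda>u. \<phi> (\<alpha>', u)) ` closed_segment p q"
      "\<phi> (\<alpha>', q) \<in> (\<lambda>u. \<phi> (\<alpha>', u)) ` closed_segment p q" by auto
    ultimately have "t' \<in> (\<lambda>u. \<phi> (\<alpha>', u)) ` closed_segment p q"
      using s(2)[of \<alpha>' t'] * connectedD_interval[of "(\<lambda>u. \<phi> (\<alpha>', u)) ` closed_segment p q" "\<phi> (\<alpha>', p)" "\<phi> (\<alpha>', q)" t'] by auto
    then show "y \<in> curves W"
      using D' seg w(2) by (force simp: curves_def y')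
  qed (use s r in auto)
qed

section \<open>Directions adapted to a point of the domain\<close>

text \<open>The directions come from \<open>separating_directions\<close> for the gradients at
  \<open>a\<close>, \<open>\<alpha>0\<close>, \<open>b\<close>, with \<open>a\<close> and
  \<open>b\<close> slightly to either side of \<open>\<alpha>0\<close>. Beyond \<open>a\<close> and
  \<open>b\<close>, angle monotonicity confines the gradient to the double cone handled by
  \<open>cone_sign\<close>. Only conditions at the two parameters \<open>a\<close>, \<open>b\<close>
  have to persist near \<open>x0\<close>, so one radius serves for all \<alpha>, however
  large.\<close>

lemma local_directions:
  assumes "(\<alpha>0, x0) \<in> D" "\<rho> > 0"
  obtains e1 e r where "r > 0"
    "\<And>\<alpha> x. \<bar>\<alpha> - \<alpha>0\<bar> < r \<Longrightarrow> dist x x0 < r \<Longrightarrow> (\<alpha>, x) \<in> D \<and> G (\<alpha>, x) \<bullet> e1 > 0 \<and> G (\<alpha>, x) \<bullet> e > 0"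
    "\<And>\<alpha> x. (\<alpha>, x) \<in> D \<Longrightarrow> dist x x0 < r \<Longrightarrow> \<rho> \<le> \<bar>\<alpha> - \<alpha>0\<bar> \<Longrightarrow>
       (G (\<alpha>, x) \<bullet> e1) * (G (\<alpha>, x) \<bullet> (e1 + e)) \<le> 0"
proof -
  obtain r where r: "r > 0" "\<And>\<alpha> x. \<bar>\<alpha> - \<alpha>0\<bar> < r \<Longrightarrow> dist x x0 < r \<Longrightarrow> (\<alpha>, x) \<in> D"
    using open_box[OF assms(1)] by metis
  \<comment> \<open>Less than \<open>r\<close>, so that \<open>a\<close> and \<open>b\<close> stay
    in the box contained in \<open>D\<close>; less than \<open>\<rho>\<close>, so that every
    \<alpha> at distance at least \<open>\<rho>\<close> from \<open>\<alpha>0\<close> lies outside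
    [a, b].\<close>
  define \<sigma> where "\<sigma> = min r \<rho> / 2"
  have \<sigma>: "\<sigma> > 0" "\<sigma> < r" "\<sigma> < \<rho>" using r assms by (auto simp: \<sigma>_def min_def)
  define a b where "a = \<alpha>0 - \<sigma>" "b = \<alpha>0 + \<sigma>"
  have ab: "a < \<alpha>0" "\<alpha>0 < b" using \<sigma> by (auto simp: a_b_def)
  have abD: "(a, x) \<in> D" "(b, x) \<in> D" if "dist x x0 < r" for x
    using \<sigma> that by (auto simp: a_b_def intro!: r)
  have x0: "(a, x0) \<in> D" "(b, x0) \<in> D" using abD r by auto
  obtain e1 e s1 s5 where e:
    "G (\<alpha>0, x0) \<bullet> e1 > 0" "G (\<alpha>0, x0) \<bullet> e > 0" "s1 * s5 * det2 (G (b, x0)) (G (a, x0)) > 0"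
    "s1 * (G (a, x0) \<bullet> e1) > 0" "s1 * (G (a, x0) \<bullet> (e1 + e)) < 0"
    "s5 * (G (b, x0) \<bullet> e1) > 0" "s5 * (G (b, x0) \<bullet> (e1 + e)) < 0"
    using separating_directions[OF det2_G[OF x0(1) assms(1) x0(2) ab]] by metis
  have tends: "((\<lambda>x. G (c, x)) \<longlongrightarrow> G (c, x0)) (nhds x0)" if "(c, x0) \<in> D" for c
  proof -
    have "isCont (\<lambda>x. G (c, x)) x0"
      by (rule isCont_o2[where g = G]) (use isCont_G[OF that] in \<open>auto intro!: continuous_intros\<close>)
    then show ?thesis
      using tendsto_at_iff_tendsto_nhds[of "\<lambda>x. G (c, x)" x0] by (simp add: isCont_def)
  qed
  note ta = tends[OF x0(1)] and tb = tends[OF x0(2)]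
  have det: "((\<lambda>x. det2 (G (b, x)) (G (a, x))) \<longlongrightarrow> det2 (G (b, x0)) (G (a, x0))) (nhds x0)"
    unfolding det2_def by (intro tendsto_intros ta tb)
  have "\<forall>\<^sub>F x in nhds x0. s1 * s5 * det2 (G (b, x)) (G (a, x)) > 0
    \<and> s1 * (G (a, x) \<bullet> e1) > 0 \<and> s1 * (G (a, x) \<bullet> (e1 + e)) < 0
    \<and> s5 * (G (b, x) \<bullet> e1) > 0 \<and> s5 * (G (b, x) \<bullet> (e1 + e)) < 0"
    by (intro eventually_conj
        order_tendstoD(1)[OF tendsto_mult[OF tendsto_const det] e(3)]
        order_tendstoD(1)[OF tendsto_mult[OF tendsto_const tendsto_inner[OF ta tendsto_const]] e(4)]
        order_tendstoD(2)[OF tendsto_mult[OF tendsto_const tendsto_inner[OF ta tendsto_const]] e(5)]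
        order_tendstoD(1)[OF tendsto_mult[OF tendsto_const tendsto_inner[OF tb tendsto_const]] e(6)]
        order_tendstoD(2)[OF tendsto_mult[OF tendsto_const tendsto_inner[OF tb tendsto_const]] e(7)])
  then obtain r1 where r1: "r1 > 0" "\<And>x. dist x x0 < r1 \<Longrightarrow> s1 * s5 * det2 (G (b, x)) (G (a, x)) > 0
    \<and> s1 * (G (a, x) \<bullet> e1) > 0 \<and> s1 * (G (a, x) \<bullet> (e1 + e)) < 0
    \<and> s5 * (G (b, x) \<bullet> e1) > 0 \<and> s5 * (G (b, x) \<bullet> (e1 + e)) < 0"
    unfolding eventually_nhds_metric by blast
  have tG: "(G \<longlongrightarrow> G (\<alpha>0, x0)) (nhds (\<alpha>0, x0))"
    using isCont_G[OF assms(1)] by (simp add: isCont_def tendsto_at_iff_tendsto_nhds)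
  have "\<forall>\<^sub>F p in nhds (\<alpha>0, x0). G p \<bullet> e1 > 0 \<and> G p \<bullet> e > 0"
    by (intro eventually_conj order_tendstoD(1)[OF tendsto_inner[OF tG tendsto_const]] e)
  then obtain r2 where r2: "r2 > 0" "\<And>p. dist p (\<alpha>0, x0) < r2 \<Longrightarrow> G p \<bullet> e1 > 0 \<and> G p \<bullet> e > 0"
    unfolding eventually_nhds_metric by blast
  show ?thesis
  proof (rule that[of "min r (min r1 (r2 / 2))" e1 e])
    show "min r (min r1 (r2 / 2)) > 0" using r r1 r2 by auto
  next
    fix \<alpha> x assume *: "\<bar>\<alpha> - \<alpha>0\<bar> < min r (min r1 (r2 / 2))" "dist x x0 < min r (min r1 (r2 / 2))"
    have "dist (\<alpha>, x) (\<alpha>0, x0) \<le> dist \<alpha> \<alpha>0 + dist x x0"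
      unfolding dist_Pair_Pair by (rule sqrt_sum_squares_le_sum) auto
    also have "\<dots> < r2" using * by (simp add: dist_real_def)
    finally show "(\<alpha>, x) \<in> D \<and> G (\<alpha>, x) \<bullet> e1 > 0 \<and> G (\<alpha>, x) \<bullet> e > 0"
      using * r r2 by auto
  next
    fix \<alpha> x assume *: "(\<alpha>, x) \<in> D" "dist x x0 < min r (min r1 (r2 / 2))" "\<rho> \<le> \<bar>\<alpha> - \<alpha>0\<bar>"
    have x: "(a, x) \<in> D" "(b, x) \<in> D" using * abD by auto
    have "a < b" using ab by simp
    have out: "b < \<alpha> \<or> \<alpha> < a" using * \<sigma> by (auto simp: a_b_def)
    \<comment> \<open>In either order of the parameters, this product arises from the one in
      \<open>det2_G\<close> by swapping arguments in two of the determinants, so the sign is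
      unchanged.\<close>
    have "det2 (G (b, x)) (G (a, x)) * det2 (G (\<alpha>, x)) (G (a, x)) * det2 (G (b, x)) (G (\<alpha>, x)) > 0"
      using out
    proof
      assume "b < \<alpha>"
      from det2_G[OF x *(1) \<open>a < b\<close> this] show ?thesis
        by (simp add: det2_swap[of "G (b, x)" "G (a, x)"] det2_swap[of "G (\<alpha>, x)" "G (a, x)"] mult_ac)
    next
      assume "\<alpha> < a"
      from det2_G[OF *(1) x this \<open>a < b\<close>] show ?thesis
        by (simp add: det2_swap[of "G (b, x)" "G (a, x)"] det2_swap[of "G (b, x)" "G (\<alpha>, x)"] mult_ac)
    qed
    then show "(G (\<alpha>, x) \<bullet> e1) * (G (\<alpha>, x) \<bullet> (e1 + e)) \<le> 0"
      using r1(2)[of x] * by (intro cone_sign[of s1 s5 "G (b, x)" "G (a, x)"]) auto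
  qed
qed

end

subsection \<open>Venetian blinds\<close>

text \<open>A bound on the outer measure, stated through a Borel superset so that images under
  \<phi> need no measurability proof.\<close>

definition thin :: "real \<Rightarrow> real set \<Rightarrow> bool" where
  "thin c S \<longleftrightarrow> (\<exists>T\<in>sets lborel. S \<subseteq> T \<and> emeasure lborel T \<le> ennreal c)"

lemma thin_empty [simp]: "thin c {}"
  by (auto simp: thin_def intro: bexI[of _ "{}"])

text \<open>The factor 2 comes from an interval centred at an arbitrary point of
  \<open>S\<close>.\<close>

lemma thin_diameter:
  assumes "\<And>s t. s \<in> S \<Longrightarrow> t \<in> S \<Longrightarrow> \<bar>s - t\<bar> \<le> c"
  shows "thin (2 * c) S"
proof (cases "S = {}")
  case False
  then obtain s where s: "s \<in> S" by auto
  have "0 \<le> c" using assms[OF s s] by simp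
  moreover have "S \<subseteq> {s - c..s + c}"
  proof
    fix t assume "t \<in> S"
    from assms[OF s this] show "t \<in> {s - c..s + c}" by auto
  qed
  ultimately show ?thesis
    by (auto simp: thin_def intro!: bexI[of _ "{s - c..s + c}"])
qed auto

lemma thin_UN:
  fixes c :: real
  assumes "finite I" "\<And>i. i \<in> I \<Longrightarrow> thin c (S i)" "0 \<le> c"
  shows "thin (card I * c) (\<Union>i\<in>I. S i)"
proof -
  obtain T where T: "\<And>i. i \<in> I \<Longrightarrow> T i \<in> sets lborel \<and> S i \<subseteq> T i \<and> emeasure lborel (T i) \<le> ennreal c"
    using assms(2) unfolding thin_def by metis
  have "emeasure lborel (\<Union>i\<in>I. T i) \<le> (\<Sum>i\<in>I. emeasure lborel (T i))"
    using T assms(1) by (intro emeasure_subadditive_finite) auto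
  also have "\<dots> \<le> (\<Sum>i\<in>I. ennreal c)"
    using T by (intro sum_mono) auto
  also have "\<dots> = ennreal (card I * c)"
    using assms(3) by (simp add: ennreal_mult' ennreal_of_nat_eq_real_of_nat)
  finally show ?thesis
    using T assms(1) unfolding thin_def by (intro bexI[of _ "\<Union>i\<in>I. T i"]) (auto 4 3)
qed

text \<open>The affine function \<open>a + s * b\<close> takes values of opposite sign, or zero, at
  \<open>s = 0\<close> and \<open>s = 1\<close>. It turns the sign condition on a gradient into a
  direction \<open>e1 + s e\<close> in which the derivative vanishes.\<close>

lemma convex_combination_zero:
  fixes a b :: real
  assumes "a * (a + b) \<le> 0"
  obtains s where "0 \<le> s" "s \<le> 1" "a + s * b = 0"
proof (cases "b = 0")
  case True
  then have "a * a \<le> 0" using assms by simp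
  then have "a = 0" by (auto simp: mult_le_0_iff)
  with True show ?thesis by (intro that[of 0]) auto
next
  case False
  have "a * b \<le> - (a * a)" using assms by (simp add: algebra_simps)
  then have 1: "a * b \<le> 0" by (meson order_trans neg_le_0_iff_le zero_le_square)
  have "(a + b) * b = (a + b) * (a + b) - a * (a + b)" by (simp add: algebra_simps)
  also have "\<dots> \<ge> 0" using assms by (smt (verit) zero_le_square)
  finally have 2: "- (a * b) \<le> b * b" by (simp add: algebra_simps)
  have bb: "b * b > 0" using False not_real_square_gt_zero[of b] by blast
  have "- (a * b) / (b * b) \<le> 1" "0 \<le> - (a * b) / (b * b)"
    using 1 2 bb by (auto simp only: pos_divide_le_eq pos_le_divide_eq)
  moreover have "a + - (a * b) / (b * b) * b = 0" using False by simp
  ultimately show ?thesis by (intro that[of "- (a * b) / (b * b)"])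
qed

lemma ex_grid_point_near:
  fixes s :: real
  assumes "0 \<le> s" "s \<le> 1" "n > 0"
  obtains j where "j < n" "\<bar>Suc j / real n - s\<bar> \<le> 1 / real n"
\<comment> \<open>The grid runs from 1/n to 1. At \<open>s = 1\<close> the floor used below would
  give \<open>j = n\<close>, one too many.\<close>
proof (cases "s = 1")
  case True
  with assms(3) show ?thesis by (intro that[of "n - 1"]) auto
next
  case False
  define j where "j = nat \<lfloor>s * n\<rfloor>"
  have j: "real j \<le> s * n" "s * n < real j + 1"
    using assms by (auto simp: j_def)
  have "s * n < n" using False assms by simp
  then have "j < n" using j by linarith
  moreover have "\<bar>Suc j / real n - s\<bar> = \<bar>Suc j - s * n\<bar> / real n"
    using assms by (simp add: field_simps)
  then have "\<bar>Suc j / real n - s\<bar> \<le> 1 / real n"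
    using j by (auto intro!: divide_right_mono)
  ultimately show ?thesis by (rule that)
qed

section \<open>Blinds and the measure of their images\<close>

text \<open>Between jumps the curve runs in direction \<open>e1 + e\<close>; each jump of the
  sawtooth sets it back along \<open>e\<close>.\<close>

definition blind :: "real^2 \<Rightarrow> real^2 \<Rightarrow> real^2 \<Rightarrow> real \<Rightarrow> nat \<Rightarrow> real \<Rightarrow> real^2" where
  "blind p e1 e \<delta> n \<tau> = p + \<tau> *\<^sub>R e1 + sawtooth \<delta> n \<tau> *\<^sub>R e"

text \<open>\<sigma> is a free trial slope; the last term is the error that
  \<open>sawtooth_cell\<close> bounds when \<sigma> is \<open>Suc j / n\<close>.\<close>

lemma blind_diff:
  "blind p e1 e \<delta> n \<tau> - blind p e1 e \<delta> n \<tau>' = (\<tau> - \<tau>') *\<^sub>R (e1 + \<sigma> *\<^sub>R e)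
     + (sawtooth \<delta> n \<tau> - sawtooth \<delta> n \<tau>' - \<sigma> * (\<tau> - \<tau>')) *\<^sub>R e"
  by (simp add: blind_def algebra_simps)

lemma same_floor_imp_dist_less:
  fixes \<tau> \<tau>' d :: real
  assumes "d > 0" "\<lfloor>\<tau> / d\<rfloor> = \<lfloor>\<tau>' / d\<rfloor>"
  shows "\<bar>\<tau> - \<tau>'\<bar> < d"
  using mult_floor_divide_bounds[OF assms(1), of \<tau>, unfolded assms(2)]
    mult_floor_divide_bounds[OF assms(1), of \<tau>']
  by linarith

context phase_function
begin

text \<open>The gradient at one base point annihilates some \<open>e1 + s e\<close>; take the scale
  \<open>j\<close> whose slope is within 1/n of \<open>s\<close>. On a subcell of length
  \<open>d = \<delta> / n ^ j\<close> the blind follows that slope up to an error of order d/n, so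
  the image has diameter of order d/n. The \<open>n ^ j\<close> subcells together contribute order
  \<delta>/n, whatever \<open>j\<close> is. The scale depends on \<alpha>, the blind does
  not.\<close>

lemma thin_shadow_of_cell:
  fixes p e1 e :: "real^2" and \<delta> B \<alpha> :: real and n :: nat and i :: int
  defines "Q \<equiv> {x. \<exists>\<tau>. \<lfloor>\<tau> / \<delta>\<rfloor> = i \<and> dist x (blind p e1 e \<delta> n \<tau>) < \<delta> / real n ^ n}"
  assumes \<delta>: "\<delta> > 0" and n: "n > 0" and U: "convex U" "Q \<subseteq> U"
    and sign: "\<And>x. x \<in> U \<Longrightarrow> (\<alpha>, x) \<in> D \<Longrightarrow> (G (\<alpha>, x) \<bullet> e1) * (G (\<alpha>, x) \<bullet> (e1 + e)) \<le> 0"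
    and bound: "\<And>x. x \<in> U \<Longrightarrow> (\<alpha>, x) \<in> D \<Longrightarrow> norm (G (\<alpha>, x)) \<le> B"
    and osc: "\<And>x y. x \<in> U \<Longrightarrow> y \<in> U \<Longrightarrow> (\<alpha>, x) \<in> D \<Longrightarrow> (\<alpha>, y) \<in> D \<Longrightarrow>
       dist x y \<le> (norm e1 + norm e + 2) * \<delta> \<Longrightarrow> norm (G (\<alpha>, x) - G (\<alpha>, y)) \<le> 1 / n"
  shows "thin (2 * (norm e1 + norm e + B * norm e + B * (2 + norm e)) * \<delta> / n)
     ((\<lambda>x. \<phi> (\<alpha>, x)) ` (Q \<inter> slice D \<alpha>))"
proof (cases "Q \<inter> slice D \<alpha> = {}")
  case False
  then obtain x0 where x0: "x0 \<in> Q" "(\<alpha>, x0) \<in> D" by (auto simp: slice_def)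
  define A where "A = norm e1 + norm e + 2"
  define C where "C = norm e1 + norm e + B * norm e + B * (2 + norm e)"
  let ?K = "blind p e1 e \<delta> n"
  have B0: "B \<ge> 0" using bound[of x0] x0 U by (auto intro: order_trans[OF norm_ge_zero])
  have C0: "C \<ge> 0" using B0 by (simp add: C_def)
  have dn: "0 < \<delta> / real n ^ j" "\<delta> / real n ^ j \<le> \<delta>" for j
    using \<delta> n by (auto simp: divide_le_eq)
  have diamQ: "dist x y \<le> A * \<delta>" if xy: "x \<in> Q" "y \<in> Q" for x y
  proof -
    obtain \<tau> \<tau>' where t: "\<lfloor>\<tau> / \<delta>\<rfloor> = i" "dist x (?K \<tau>) < \<delta> / real n ^ n"
      "\<lfloor>\<tau>' / \<delta>\<rfloor> = i" "dist y (?K \<tau>') < \<delta> / real n ^ n"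
      using xy by (auto simp: Q_def)
    have "norm (?K \<tau> - ?K \<tau>') \<le> norm ((\<tau> - \<tau>') *\<^sub>R e1) + norm ((sawtooth \<delta> n \<tau> - sawtooth \<delta> n \<tau>') *\<^sub>R e)"
      unfolding blind_diff[of p e1 e \<delta> n \<tau> \<tau>' 0] by (rule order_trans[OF norm_triangle_ineq]) simp
    also have "\<dots> \<le> \<delta> * norm e1 + \<delta> * norm e"
      unfolding norm_scaleR
      using same_floor_imp_dist_less[of \<delta> \<tau> \<tau>'] t \<delta> sawtooth_bounds[OF \<delta> n, of \<tau>] sawtooth_bounds[OF \<delta> n, of \<tau>']
      by (intro add_mono mult_right_mono) auto
    finally have "dist (?K \<tau>) (?K \<tau>') \<le> \<delta> * norm e1 + \<delta> * norm e" by (simp add: dist_norm)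
    moreover have "dist x y \<le> dist x (?K \<tau>) + dist (?K \<tau>) (?K \<tau>') + dist y (?K \<tau>')"
      using dist_triangle[of x y "?K \<tau>"] dist_triangle[of "?K \<tau>" y "?K \<tau>'"] dist_commute[of y "?K \<tau>'"]
      by linarith
    ultimately have "dist x y \<le> \<delta> * norm e1 + \<delta> * norm e + 2 * \<delta>"
      using t dn(2)[of n] by linarith
    then show ?thesis by (simp add: A_def algebra_simps)
  qed
  obtain s where s: "0 \<le> s" "s \<le> 1" "G (\<alpha>, x0) \<bullet> e1 + s * (G (\<alpha>, x0) \<bullet> e) = 0"
    using convex_combination_zero[of "G (\<alpha>, x0) \<bullet> e1" "G (\<alpha>, x0) \<bullet> e"] sign[of x0] x0 U
    by (auto simp: inner_add_right)
  obtain j where j: "j < n" "\<bar>Suc j / real n - s\<bar> \<le> 1 / real n"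
    using ex_grid_point_near[OF s(1,2) n] by metis
  \<comment> \<open>At the scale \<open>\<delta> / n ^ j\<close> the blind runs in a direction in which \<open>\<phi>\<^sub>\<alpha>\<close> is almost stationary.\<close>
  define \<sigma> where "\<sigma> = Suc j / real n"
  have \<sigma>: "0 \<le> \<sigma>" "\<sigma> \<le> 1" using j by (auto simp: \<sigma>_def)
  define d where "d = \<delta> / real n ^ j"
  have d: "d > 0" using dn by (simp add: d_def)
  have slope: "\<bar>G (\<alpha>, z) \<bullet> (e1 + \<sigma> *\<^sub>R e)\<bar> \<le> (norm e1 + norm e + B * norm e) / n"
    if z: "(\<alpha>, z) \<in> D" "z \<in> U" "dist z x0 \<le> A * \<delta>" for z
  proof -
    have "G (\<alpha>, z) \<bullet> (e1 + \<sigma> *\<^sub>R e) = (G (\<alpha>, z) - G (\<alpha>, x0)) \<bullet> (e1 + \<sigma> *\<^sub>R e) + (\<sigma> - s) * (G (\<alpha>, x0) \<bullet> e)"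
      using s(3) by (simp add: algebra_simps)
    moreover have "\<bar>(G (\<alpha>, z) - G (\<alpha>, x0)) \<bullet> (e1 + \<sigma> *\<^sub>R e)\<bar> \<le> 1 / n * (norm e1 + norm e)"
    proof (rule order_trans[OF Cauchy_Schwarz_ineq2 mult_mono])
      show "norm (G (\<alpha>, z) - G (\<alpha>, x0)) \<le> 1 / n"
        using osc[of z x0] z x0 U by (auto simp: A_def)
      have "norm (e1 + \<sigma> *\<^sub>R e) \<le> norm e1 + \<bar>\<sigma>\<bar> * norm e"
        by (rule order_trans[OF norm_triangle_ineq]) simp
      also have "\<dots> \<le> norm e1 + norm e"
        using \<sigma> by (auto intro: mult_left_le_one_le)
      finally show "norm (e1 + \<sigma> *\<^sub>R e) \<le> norm e1 + norm e" .
    qed auto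
    moreover have "\<bar>(\<sigma> - s) * (G (\<alpha>, x0) \<bullet> e)\<bar> \<le> 1 / n * (B * norm e)"
      unfolding abs_mult
    proof (rule mult_mono)
      show "\<bar>\<sigma> - s\<bar> \<le> 1 / n" using j by (simp add: \<sigma>_def)
      have "norm (G (\<alpha>, x0)) \<le> B" using bound[of x0] x0 U by auto
      then show "\<bar>G (\<alpha>, x0) \<bullet> e\<bar> \<le> B * norm e"
        by (intro order_trans[OF Cauchy_Schwarz_ineq2] mult_right_mono) auto
    qed auto
    ultimately have "\<bar>G (\<alpha>, z) \<bullet> (e1 + \<sigma> *\<^sub>R e)\<bar> \<le> 1 / n * (norm e1 + norm e) + 1 / n * (B * norm e)"
      by linarith
    then show ?thesis by (simp add: add_divide_distrib algebra_simps)
  qed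
  define S where "S m = {\<phi> (\<alpha>, x) |x. (\<alpha>, x) \<in> D \<and> (\<exists>\<tau>. \<lfloor>\<tau> / \<delta>\<rfloor> = i \<and> \<lfloor>\<tau> / d\<rfloor> = m \<and> dist x (?K \<tau>) < \<delta> / real n ^ n)}" for m
  have thin_S: "thin (2 * (C * d / n)) (S m)" for m
  proof (rule thin_diameter)
    fix a b assume "a \<in> S m" "b \<in> S m"
    then obtain x y \<tau> \<tau>' where x: "a = \<phi> (\<alpha>, x)" "(\<alpha>, x) \<in> D" "\<lfloor>\<tau> / \<delta>\<rfloor> = i" "\<lfloor>\<tau> / d\<rfloor> = m" "dist x (?K \<tau>) < \<delta> / real n ^ n"
      and y: "b = \<phi> (\<alpha>, y)" "(\<alpha>, y) \<in> D" "\<lfloor>\<tau>' / \<delta>\<rfloor> = i" "\<lfloor>\<tau>' / d\<rfloor> = m" "dist y (?K \<tau>') < \<delta> / real n ^ n"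
      by (auto simp: S_def)
    have xyQ: "x \<in> Q" "y \<in> Q" using x y by (auto simp: Q_def)
    obtain z where z: "z \<in> closed_segment y x" "(\<alpha>, z) \<in> D" "a - b = G (\<alpha>, z) \<bullet> (x - y)"
      using slice_mvt[OF y(2) x(2)] x(1) y(1) by metis
    have zU: "z \<in> U" using z(1) xyQ U closed_segment_subset by blast
    have "closed_segment y x \<subseteq> cball x0 (A * \<delta>)"
      using diamQ[OF x0(1)] xyQ by (intro closed_segment_subset) auto
    then have zx: "dist z x0 \<le> A * \<delta>" using z(1) by (auto simp: dist_commute)
    define w where "w = (x - ?K \<tau>) - (y - ?K \<tau>') + (sawtooth \<delta> n \<tau> - sawtooth \<delta> n \<tau>' - \<sigma> * (\<tau> - \<tau>')) *\<^sub>R e"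
    have xy: "x - y = (\<tau> - \<tau>') *\<^sub>R (e1 + \<sigma> *\<^sub>R e) + w"
      using blind_diff[of p e1 e \<delta> n \<tau> \<tau>' \<sigma>] by (simp add: w_def algebra_simps)
    have tau: "\<bar>\<tau> - \<tau>'\<bar> \<le> d"
      using same_floor_imp_dist_less[OF d, of \<tau> \<tau>'] x y by auto
    have dS: "\<delta> / real n ^ Suc j = d / n" by (simp add: d_def)
    have "norm w \<le> \<delta> / real n ^ n + \<delta> / real n ^ n + \<delta> / real n ^ Suc j * norm e"
      unfolding w_def
    proof (rule norm_triangle_mono[OF order_trans[OF norm_triangle_ineq4 add_mono]])
      show "norm (x - ?K \<tau>) \<le> \<delta> / real n ^ n" "norm (y - ?K \<tau>') \<le> \<delta> / real n ^ n"
        using x y by (auto simp: dist_norm)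
      show "norm ((sawtooth \<delta> n \<tau> - sawtooth \<delta> n \<tau>' - \<sigma> * (\<tau> - \<tau>')) *\<^sub>R e) \<le> \<delta> / real n ^ Suc j * norm e"
        using sawtooth_cell[OF \<delta> n j(1), of \<tau> \<tau>'] x y unfolding norm_scaleR \<sigma>_def d_def
        by (intro mult_right_mono) auto
    qed
    \<comment> \<open>Here the tube radius pays off: since \<open>j < n\<close>, it is at most the
      sawtooth error at whichever scale was selected.\<close>
    moreover have "\<delta> / real n ^ n \<le> \<delta> / real n ^ Suc j"
      using \<delta> n j by (intro divide_left_mono power_increasing) auto
    ultimately have "norm w \<le> d / n + d / n + d / n * norm e"
      unfolding dS by linarith
    then have w: "norm w \<le> d / n * (2 + norm e)"
      by (simp add: distrib_left mult.commute)
    have "\<bar>a - b\<bar> = \<bar>(\<tau> - \<tau>') * (G (\<alpha>, z) \<bullet> (e1 + \<sigma> *\<^sub>R e)) + G (\<alpha>, z) \<bullet> w\<bar>"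
      unfolding z(3) xy by (simp add: inner_add_right)
    also have "\<dots> \<le> \<bar>\<tau> - \<tau>'\<bar> * \<bar>G (\<alpha>, z) \<bullet> (e1 + \<sigma> *\<^sub>R e)\<bar> + norm (G (\<alpha>, z)) * norm w"
      by (intro order_trans[OF abs_triangle_ineq] add_mono Cauchy_Schwarz_ineq2) (simp add: abs_mult)
    also have "\<dots> \<le> d * ((norm e1 + norm e + B * norm e) / n) + B * (d / n * (2 + norm e))"
      using tau slope[OF z(2) zU zx] bound[OF zU z(2)] w d B0
      by (intro add_mono mult_mono) auto
    also have "\<dots> = C * d / n" by (simp add: C_def add_divide_distrib algebra_simps)
    finally show "\<bar>a - b\<bar> \<le> C * d / n" .
  qed
  \<comment> \<open>A cell of length \<delta> consists of \<open>n ^ j\<close> subcells of length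
    \<open>d\<close>, so the powers of \<open>n\<close> cancel in the total.\<close>
  have "thin (card {i * int n ^ j..<(i + 1) * int n ^ j} * (2 * (C * d / n)))
      (\<Union>m\<in>{i * int n ^ j..<(i + 1) * int n ^ j}. S m)"
    by (rule thin_UN[OF finite_atLeastLessThan_int]) (use C0 d thin_S in auto)
  also have "card {i * int n ^ j..<(i + 1) * int n ^ j} * (2 * (C * d / n)) = 2 * C * \<delta> / n"
  proof -
    have "nat ((i + 1) * int n ^ j - i * int n ^ j) = n ^ j"
      by (simp add: algebra_simps nat_power_eq)
    then show ?thesis using n by (simp add: d_def)
  qed
  finally obtain T where T: "T \<in> sets lborel" "emeasure lborel T \<le> ennreal (2 * C * \<delta> / n)"
    "(\<Union>m\<in>{i * int n ^ j..<(i + 1) * int n ^ j}. S m) \<subseteq> T"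
    by (auto simp: thin_def)
  have "(\<lambda>x. \<phi> (\<alpha>, x)) ` (Q \<inter> slice D \<alpha>) \<subseteq> (\<Union>m\<in>{i * int n ^ j..<(i + 1) * int n ^ j}. S m)"
  proof (rule image_subsetI)
    fix x assume "x \<in> Q \<inter> slice D \<alpha>"
    then obtain \<tau> where \<tau>: "(\<alpha>, x) \<in> D" "\<lfloor>\<tau> / \<delta>\<rfloor> = i" "dist x (?K \<tau>) < \<delta> / real n ^ n"
      by (auto simp: Q_def slice_def)
    have i: "real_of_int i \<le> \<tau> / \<delta>" "\<tau> / \<delta> < real_of_int i + 1" using \<tau>(2) by linarith+
    have \<tau>d: "\<tau> / d = \<tau> / \<delta> * real n ^ j" by (simp add: d_def)
    have "real_of_int (i * int n ^ j) \<le> \<tau> / d"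
      using mult_right_mono[OF i(1), of "real n ^ j"] unfolding \<tau>d by simp
    moreover have "\<tau> / d < real_of_int ((i + 1) * int n ^ j)"
      using mult_strict_right_mono[OF i(2), of "real n ^ j"] n unfolding \<tau>d by simp
    ultimately have "\<lfloor>\<tau> / d\<rfloor> \<in> {i * int n ^ j..<(i + 1) * int n ^ j}"
      unfolding atLeastLessThan_iff le_floor_iff floor_less_iff by (rule conjI)
    moreover have "\<phi> (\<alpha>, x) \<in> S \<lfloor>\<tau> / d\<rfloor>" using \<tau> unfolding S_def by blast
    ultimately show "\<phi> (\<alpha>, x) \<in> (\<Union>m\<in>{i * int n ^ j..<(i + 1) * int n ^ j}. S m)" by (rule UN_I)
  qed
  from subset_trans[OF this T(3)] T(2) show ?thesis
    unfolding thin_def C_def[symmetric] by (intro bexI[OF _ T(1)] conjI)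
qed auto

end

text \<open>Tonelli's theorem: \<open>X\<close> is Borel, so the outer bounds on its slices are
  bounds on their measure and can be integrated over the interval.\<close>

lemma emeasure_le_of_thin_slices:
  fixes X :: "(real \<times> real) set"
  assumes X: "X \<in> sets borel" and M: "0 \<le> M" and c: "0 \<le> c"
    and sub: "X \<subseteq> {-M..M} \<times> UNIV" and thin: "\<And>\<alpha>. \<alpha> \<in> {-M..M} \<Longrightarrow> thin c (Pair \<alpha> -` X)"
  shows "emeasure lborel X \<le> ennreal (2 * M * c)"
proof -
  have X': "X \<in> sets (lborel \<Otimes>\<^sub>M lborel)" using X by (simp only: lborel_prod sets_lborel)
  have "emeasure lborel X = emeasure (lborel \<Otimes>\<^sub>M lborel) X" by (simp only: lborel_prod)
  also have "\<dots> = (\<integral>\<^sup>+ \<alpha>. emeasure lborel (Pair \<alpha> -` X) \<partial>lborel)"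
    using X' by (rule lborel.emeasure_pair_measure_alt)
  also have "\<dots> \<le> (\<integral>\<^sup>+ \<alpha>. ennreal c * indicator {-M..M} \<alpha> \<partial>lborel)"
  proof (rule nn_integral_mono)
    fix \<alpha> :: real
    show "emeasure lborel (Pair \<alpha> -` X) \<le> ennreal c * indicator {-M..M} \<alpha>"
    proof (cases "\<alpha> \<in> {-M..M}")
      case True
      then obtain T where "T \<in> sets lborel" "Pair \<alpha> -` X \<subseteq> T" "emeasure lborel T \<le> ennreal c"
        using thin[OF True] unfolding thin_def by blast
      then show ?thesis
        using True emeasure_mono[of "Pair \<alpha> -` X" T lborel] by (auto intro: order_trans)
    next
      case False
      then have "Pair \<alpha> -` X = {}" using sub by auto
      then show ?thesis by simp
    qed
  qed
  also have "\<dots> = ennreal c * ennreal (2 * M)"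
    using M by (subst nn_integral_cmult_indicator) auto
  also have "\<dots> = ennreal (2 * M * c)"
    using M c by (simp add: mult.commute flip: ennreal_mult')
  finally show ?thesis .
qed

section \<open>A whole blind: full image for some parameters, small image for others\<close>

context phase_function
begin

lemma \<phi>_le_along:
  assumes "0 \<le> u" "(\<alpha>, x) \<in> D" "(\<alpha>, x + u *\<^sub>R v) \<in> D"
    and "\<And>z. z \<in> closed_segment x (x + u *\<^sub>R v) \<Longrightarrow> (\<alpha>, z) \<in> D \<Longrightarrow> G (\<alpha>, z) \<bullet> v > 0"
  shows "\<phi> (\<alpha>, x) \<le> \<phi> (\<alpha>, x + u *\<^sub>R v)" "0 < u \<Longrightarrow> \<phi> (\<alpha>, x) < \<phi> (\<alpha>, x + u *\<^sub>R v)"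
proof -
  obtain z where z: "z \<in> closed_segment x (x + u *\<^sub>R v)" "(\<alpha>, z) \<in> D"
    "\<phi> (\<alpha>, x + u *\<^sub>R v) - \<phi> (\<alpha>, x) = u * (G (\<alpha>, z) \<bullet> v)"
    using slice_mvt[OF assms(2,3)] by (metis add_diff_cancel_left' inner_scaleR_right)
  have "G (\<alpha>, z) \<bullet> v > 0" using assms(4) z by blast
  then show "\<phi> (\<alpha>, x) \<le> \<phi> (\<alpha>, x + u *\<^sub>R v)" "0 < u \<Longrightarrow> \<phi> (\<alpha>, x) < \<phi> (\<alpha>, x + u *\<^sub>R v)"
    using z(3) mult_nonneg_nonneg[of u "G (\<alpha>, z) \<bullet> v"] mult_pos_pos[of u "G (\<alpha>, z) \<bullet> v"] assms(1)
    by linarith+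
qed

text \<open>Along the blind, \<open>\<phi>\<close> at the parameter \<alpha> is right continuous,
  and since it increases in direction \<open>e\<close>, the setbacks along \<open>e\<close> only
  make it jump down. \<open>IVT_downward_jumps\<close> then applies.\<close>

lemma blind_covers:
  assumes \<delta>: "0 < \<delta>" "\<delta> \<le> l" and n: "n > 0" and U: "compact U" "convex U"
    and inD: "\<And>z. z \<in> U \<Longrightarrow> (\<alpha>, z) \<in> D" and pos: "\<And>z. z \<in> U \<Longrightarrow> G (\<alpha>, z) \<bullet> e > 0"
    and inU: "\<And>\<tau> u. 0 \<le> \<tau> \<Longrightarrow> \<tau> \<le> l \<Longrightarrow> 0 \<le> u \<Longrightarrow> u \<le> 2 * l \<Longrightarrow> p + \<tau> *\<^sub>R e1 + u *\<^sub>R e \<in> U"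
    and t: "\<phi> (\<alpha>, p) \<le> t" "t \<le> \<phi> (\<alpha>, p + l *\<^sub>R e1)"
  shows "\<exists>\<tau>\<in>{0..l}. \<phi> (\<alpha>, blind p e1 e \<delta> n \<tau>) = t"
proof (rule IVT_downward_jumps)
  let ?K = "blind p e1 e \<delta> n"
  let ?h = "sawtooth \<delta> n"
  have l: "l > 0" using \<delta> by simp
  note h = sawtooth_bounds[OF \<delta>(1) n]
  have hl: "?h \<tau> \<le> 2 * l" for \<tau> using h(2)[of \<tau>] \<delta> by simp
  have KU: "?K \<tau> \<in> U" if "0 \<le> \<tau>" "\<tau> \<le> l" for \<tau>
    unfolding blind_def using that h hl by (intro inU) auto
  have up: "\<phi> (\<alpha>, x) \<le> \<phi> (\<alpha>, x + u *\<^sub>R e)" if "0 \<le> u" "x \<in> U" "x + u *\<^sub>R e \<in> U" for x u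
    using that closed_segment_subset[OF that(2,3) U(2)] pos by (intro \<phi>_le_along inD) auto
  show "0 \<le> l" using l by simp
  show "\<phi> (\<alpha>, ?K 0) \<le> t" using t by (simp add: blind_def)
  \<comment> \<open>The blind ends at this point shifted by a nonnegative multiple of
    \<open>e\<close>.\<close>
  have "\<phi> (\<alpha>, p + l *\<^sub>R e1) \<le> \<phi> (\<alpha>, ?K l)"
    unfolding blind_def using up[of "?h l" "p + l *\<^sub>R e1"] inU[of l 0] inU[of l "?h l"] h hl l by simp
  then show "t \<le> \<phi> (\<alpha>, ?K l)" using t by simp
  have cont: "continuous_on U (\<lambda>z. \<phi> (\<alpha>, z))"
    by (rule continuous_on_compose2[OF cont_\<phi>]) (auto intro!: continuous_intros inD)
  show "((\<lambda>\<tau>. \<phi> (\<alpha>, ?K \<tau>)) \<longlongrightarrow> \<phi> (\<alpha>, ?K x)) (at_right x)" if "0 \<le> x" "x < l" for x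
  proof -
    have "((\<lambda>\<tau>. (\<alpha>, ?K \<tau>)) \<longlongrightarrow> (\<alpha>, ?K x)) (at_right x)"
      unfolding blind_def by (intro tendsto_intros sawtooth_right_continuous \<delta> n)
    moreover have "isCont \<phi> (\<alpha>, ?K x)"
      using that by (intro isCont_\<phi> inD KU) auto
    ultimately show ?thesis by (rule isCont_tendsto_compose[rotated])
  qed
  show "eventually (\<lambda>y. \<phi> (\<alpha>, ?K x) < \<phi> (\<alpha>, ?K y) + c) (at_left x)" if x: "0 < x" "x \<le> l" and c: "c > 0" for x c
  proof -
    obtain d where d: "d > 0" "\<And>z z'. z \<in> U \<Longrightarrow> z' \<in> U \<Longrightarrow> dist z' z < d \<Longrightarrow> dist (\<phi> (\<alpha>, z')) (\<phi> (\<alpha>, z)) < c"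
      using compact_uniformly_continuous[OF cont U(1)] c unfolding uniformly_continuous_on_def by metis
    \<comment> \<open>The summand 1 avoids division by zero when \<open>e1 + e = 0\<close>; the
      maximum keeps \<open>y\<close> in the parameter interval.\<close>
    define b where "b = max 0 (x - d / (norm (e1 + e) + 1))"
    have N: "norm (e1 + e) + 1 > 0" by (simp add: add_nonneg_pos)
    have "b < x" using x d N by (auto simp: b_def)
    then have "eventually (\<lambda>y. y \<in> {b<..<x}) (at_left x)"
      by (rule eventually_at_left_real)
    then show ?thesis
    proof eventually_elim
      case (elim y)
      have y: "0 \<le> y" "y < x" "y \<le> l" "x - y < d / (norm (e1 + e) + 1)" using elim x by (auto simp: b_def)
      \<comment> \<open>The point reached from parameter \<open>y\<close> by running along
        \<open>e1 + e\<close> without jumping. By \<open>sawtooth_diff_le\<close> the true point at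
        \<open>x\<close> lies behind it in direction \<open>e\<close>. Its offset along
        \<open>e\<close> is at most \<delta> + l, which explains the range up to
        \<open>2 * l\<close> in \<open>inU\<close>.\<close>
      define z where "z = ?K y + (x - y) *\<^sub>R (e1 + e)"
      have z: "z = p + x *\<^sub>R e1 + (?h y + (x - y)) *\<^sub>R e"
        by (simp add: z_def blind_def algebra_simps)
      have zU: "z \<in> U" unfolding z using y x h[of y] \<delta> by (intro inU) auto
      have "z = ?K x + (?h y + (x - y) - ?h x) *\<^sub>R e"
        by (simp add: z blind_def algebra_simps)
      moreover have "?h y + (x - y) - ?h x \<ge> 0"
        using sawtooth_diff_le[OF \<delta>(1) n, of y x] y by simp
      ultimately have "\<phi> (\<alpha>, ?K x) \<le> \<phi> (\<alpha>, z)"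
        using up[of "?h y + (x - y) - ?h x" "?K x"] zU KU[of x] x by simp
      moreover have "dist z (?K y) < d"
      proof -
        have "dist z (?K y) = (x - y) * norm (e1 + e)" using y by (simp add: z_def dist_norm)
        also have "\<dots> \<le> (x - y) * (norm (e1 + e) + 1)" using y by (intro mult_left_mono) auto
        also have "\<dots> < d" using y(4) N by (simp add: pos_less_divide_eq)
        finally show ?thesis .
      qed
      then have "dist (\<phi> (\<alpha>, z)) (\<phi> (\<alpha>, ?K y)) < c"
        using d(2)[of "?K y" z] zU KU y by auto
      ultimately show ?case by (auto simp: dist_real_def)
    qed
  qed
qed

text \<open>Because of its right endpoint, the closed interval meets the \<open>k + 1\<close> cells
  with indices 0 to \<open>k\<close>. Their total length is at most \<open>2 * l\<close>, whence the
  range in \<open>inU\<close> and the factor 4.\<close>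

lemma thin_shadow_of_blind:
  fixes p e1 e :: "real^2" and l B \<alpha> :: real and n k :: nat
  defines "\<delta> \<equiv> l / k"
  assumes l: "l > 0" and k: "k > 0" and n: "n > 0" and U: "convex U"
    and inU: "\<And>x \<tau>. 0 \<le> \<tau> \<Longrightarrow> \<tau> \<le> 2 * l \<Longrightarrow> dist x (blind p e1 e \<delta> n \<tau>) < \<delta> / real n ^ n \<Longrightarrow> x \<in> U"
    and sign: "\<And>x. x \<in> U \<Longrightarrow> (\<alpha>, x) \<in> D \<Longrightarrow> (G (\<alpha>, x) \<bullet> e1) * (G (\<alpha>, x) \<bullet> (e1 + e)) \<le> 0"
    and B: "0 \<le> B" and bound: "\<And>x. x \<in> U \<Longrightarrow> (\<alpha>, x) \<in> D \<Longrightarrow> norm (G (\<alpha>, x)) \<le> B"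
    and osc: "\<And>x y. x \<in> U \<Longrightarrow> y \<in> U \<Longrightarrow> (\<alpha>, x) \<in> D \<Longrightarrow> (\<alpha>, y) \<in> D \<Longrightarrow>
       dist x y \<le> (norm e1 + norm e + 2) * \<delta> \<Longrightarrow> norm (G (\<alpha>, x) - G (\<alpha>, y)) \<le> 1 / n"
  shows "thin (4 * (norm e1 + norm e + B * norm e + B * (2 + norm e)) * l / n)
     ((\<lambda>x. \<phi> (\<alpha>, x)) ` ({x. \<exists>\<tau>\<in>{0..l}. dist x (blind p e1 e \<delta> n \<tau>) < \<delta> / real n ^ n} \<inter> slice D \<alpha>))"
    (is "thin _ (_ ` (?W \<inter> _))")
proof -
  define C where "C = norm e1 + norm e + B * norm e + B * (2 + norm e)"
  have C: "C \<ge> 0" using B by (simp add: C_def)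
  have \<delta>: "\<delta> > 0" using l k by (simp add: \<delta>_def)
  have dk: "real k * \<delta> = l" using k by (simp add: \<delta>_def)
  have dl: "\<delta> \<le> l" using l k by (simp add: \<delta>_def divide_le_eq)
  define Q where "Q i = {x. \<exists>\<tau>. \<lfloor>\<tau> / \<delta>\<rfloor> = i \<and> dist x (blind p e1 e \<delta> n \<tau>) < \<delta> / real n ^ n}" for i
  have cell_thin: "thin (2 * C * \<delta> / n) ((\<lambda>x. \<phi> (\<alpha>, x)) ` (Q i \<inter> slice D \<alpha>))" if i: "i \<in> {0..int k}" for i
    unfolding Q_def C_def
  proof (rule thin_shadow_of_cell[OF \<delta> n U _ sign bound osc])
    show "{x. \<exists>\<tau>. \<lfloor>\<tau> / \<delta>\<rfloor> = i \<and> dist x (blind p e1 e \<delta> n \<tau>) < \<delta> / real n ^ n} \<subseteq> U"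
    proof clarify
      fix x \<tau> assume *: "dist x (blind p e1 e \<delta> n \<tau>) < \<delta> / real n ^ n" "i = \<lfloor>\<tau> / \<delta>\<rfloor>"
      have "0 \<le> \<tau> / \<delta>" "\<tau> / \<delta> < real k + 1" using i *(2) by (simp, simp add: floor_le_iff)
      then have "0 \<le> \<tau>" "\<tau> < (real k + 1) * \<delta>"
        using \<delta> by (simp_all add: zero_le_divide_iff pos_divide_less_eq)
      moreover have "(real k + 1) * \<delta> \<le> 2 * l" using dk dl by (simp add: distrib_right)
      ultimately show "x \<in> U" using inU *(1) by simp
    qed
  qed auto
  have "thin (real (card {0..int k}) * (2 * C * \<delta> / n)) (\<Union>i\<in>{0..int k}. (\<lambda>x. \<phi> (\<alpha>, x)) ` (Q i \<inter> slice D \<alpha>))"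
    by (rule thin_UN) (use cell_thin C \<delta> in auto)
  then obtain T where T: "T \<in> sets lborel" "(\<Union>i\<in>{0..int k}. (\<lambda>x. \<phi> (\<alpha>, x)) ` (Q i \<inter> slice D \<alpha>)) \<subseteq> T"
    "emeasure lborel T \<le> ennreal (real (card {0..int k}) * (2 * C * \<delta> / n))"
    by (auto simp: thin_def)
  have "real (card {0..int k}) * (2 * C * \<delta> / n) \<le> 4 * C * l / n"
  proof -
    have "real (card {0..int k}) * \<delta> \<le> 2 * l" using dk dl by (simp add: distrib_right)
    then have "2 * C / n * (real (card {0..int k}) * \<delta>) \<le> 2 * C / n * (2 * l)"
      using C by (intro mult_left_mono) auto
    then show ?thesis by (simp add: mult_ac)
  qed
  then have "emeasure lborel T \<le> ennreal (4 * C * l / n)"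
    using T(3) ennreal_leI order_trans by blast
  moreover have "?W \<subseteq> (\<Union>i\<in>{0..int k}. Q i)"
  proof clarify
    fix x \<tau> assume *: "\<tau> \<in> {0..l}" "dist x (blind p e1 e \<delta> n \<tau>) < \<delta> / real n ^ n"
    have "0 \<le> \<tau> / \<delta>" "\<tau> / \<delta> \<le> real k" using * \<delta> dk by (auto simp: pos_divide_le_eq)
    then have "\<lfloor>\<tau> / \<delta>\<rfloor> \<in> {0..int k}" by (simp add: floor_le_iff)
    moreover have "x \<in> Q \<lfloor>\<tau> / \<delta>\<rfloor>" using * by (auto simp: Q_def)
    ultimately show "x \<in> (\<Union>i\<in>{0..int k}. Q i)" by (rule UN_I)
  qed
  then have "(\<lambda>x. \<phi> (\<alpha>, x)) ` (?W \<inter> slice D \<alpha>) \<subseteq> T" using T(2) by fastforce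
  ultimately show ?thesis unfolding thin_def C_def[symmetric] using T(1) by (intro bexI[of _ T] conjI)
qed

text \<open>
  The neighbourhood \<open>N\<close> does not depend on \<open>\<epsilon>\<close>: by the Lindelof property, countably many such
  neighbourhoods suffice, and only then are the individual errors chosen.
\<close>

lemma efficient_local_cover:
  assumes z0: "(\<alpha>0, x0) \<in> D" and V: "open V" "x0 \<in> V" and Q: "open Q" "(\<alpha>0, \<phi> (\<alpha>0, x0)) \<in> Q"
  obtains N C where "open N" "(\<alpha>0, \<phi> (\<alpha>0, x0)) \<in> N" "compact C" "C \<subseteq> V"
    "\<And>\<alpha> t x. (\<alpha>, t) \<in> N \<Longrightarrow> x \<in> C \<Longrightarrow> (\<alpha>, x) \<in> D"
    "\<And>M \<epsilon>. 0 \<le> M \<Longrightarrow> 0 < \<epsilon> \<Longrightarrow> \<exists>W. open W \<and> W \<subseteq> C \<and> (\<forall>\<alpha> t. (\<alpha>, t) \<in> N \<longrightarrow> (\<exists>x\<in>W. (\<alpha>, x) \<in> D \<and> \<phi> (\<alpha>, x) = t))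
       \<and> emeasure lborel ((curves W - Q) \<inter> ({-M..M} \<times> UNIV)) \<le> ennreal \<epsilon>"
proof -
  have "continuous (at (\<alpha>0, x0)) (\<lambda>p. (fst p, \<phi> p))"
    using isCont_\<phi>[OF z0] by (intro continuous_intros)
  then have "((\<lambda>p. (fst p, \<phi> p)) \<longlongrightarrow> (\<alpha>0, \<phi> (\<alpha>0, x0))) (nhds (\<alpha>0, x0))"
    using tendsto_at_iff_tendsto_nhds[of "\<lambda>p. (fst p, \<phi> p)" "(\<alpha>0, x0)"] by (simp add: isCont_def)
  then have "eventually (\<lambda>p. (fst p, \<phi> p) \<in> Q) (nhds (\<alpha>0, x0))"
    using Q by (rule topological_tendstoD)
  \<comment> \<open>Curves of points near \<open>x0\<close> stay in \<open>Q\<close> as long as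
    \<alpha> is near \<open>\<alpha>0\<close>. So excess can occur only for \<alpha> at distance at
    least \<open>\<rho> / 2\<close>, where the sign condition below makes the image of the blind
    small.\<close>
  then obtain \<rho> where \<rho>: "\<rho> > 0" "\<And>p. dist p (\<alpha>0, x0) < \<rho> \<Longrightarrow> (fst p, \<phi> p) \<in> Q"
    unfolding eventually_nhds_metric by blast
  obtain e1 e r where r: "r > 0"
    "\<And>\<alpha> x. \<bar>\<alpha> - \<alpha>0\<bar> < r \<Longrightarrow> dist x x0 < r \<Longrightarrow> (\<alpha>, x) \<in> D \<and> G (\<alpha>, x) \<bullet> e1 > 0 \<and> G (\<alpha>, x) \<bullet> e > 0"
    and sign: "\<And>\<alpha> x. (\<alpha>, x) \<in> D \<Longrightarrow> dist x x0 < r \<Longrightarrow> \<rho> / 2 \<le> \<bar>\<alpha> - \<alpha>0\<bar> \<Longrightarrow>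
       (G (\<alpha>, x) \<bullet> e1) * (G (\<alpha>, x) \<bullet> (e1 + e)) \<le> 0"
    using local_directions[OF z0, of "\<rho> / 2"] \<rho>(1) by (metis half_gt_zero)
  obtain v where v: "v > 0" "cball x0 v \<subseteq> V"
    using V by (auto simp: open_contains_cball)
  define R where "R = min v (min r (\<rho> / 2)) / 2"
  have R: "R > 0" "R \<le> v" "R < r" "R < \<rho> / 2" using v r \<rho> by (auto simp: R_def min_def)
  define U where "U = cball x0 R"
  have U: "compact U" "convex U" by (simp_all add: U_def)
  define A where "A = norm e1 + norm e + 2"
  have A: "A \<ge> 2" by (simp add: A_def)
  \<comment> \<open>Small enough that the blind, continued to parameter \<open>2 * l\<close>,
    shifted by up to \<open>2 * l\<close> along \<open>e\<close> and thickened by \<open>l\<close>,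
    remains in the ball \<open>U\<close>.\<close>
  define l where "l = R / (3 * A)"
  have l: "l > 0" "3 * A * l = R" using R A by (auto simp: l_def)
  \<comment> \<open>\<open>x0\<close> is the midpoint of the base segment from \<open>p\<close> to
    \<open>p + l e1\<close>, so its value lies strictly between those at the ends.\<close>
  define p where "p = x0 - (l / 2) *\<^sub>R e1"
  have inU: "p + \<tau> *\<^sub>R e1 + u *\<^sub>R e + w \<in> U"
    if "0 \<le> \<tau>" "\<tau> \<le> 2 * l" "0 \<le> u" "u \<le> 2 * l" "norm w \<le> l" for \<tau> u w
  proof -
    have "norm ((\<tau> - l / 2) *\<^sub>R e1 + u *\<^sub>R e + w) \<le> \<bar>\<tau> - l / 2\<bar> * norm e1 + \<bar>u\<bar> * norm e + norm w"
      by (intro norm_triangle_mono) auto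
    also have "\<dots> \<le> 2 * l * norm e1 + 2 * l * norm e + l"
      using that l by (intro add_mono mult_right_mono) auto
    also have "\<dots> \<le> R"
    proof -
      have "2 * l * norm e1 \<le> 3 * l * norm e1" "2 * l * norm e \<le> 3 * l * norm e"
        using l by (auto intro!: mult_right_mono)
      then have "2 * l * norm e1 + 2 * l * norm e + l \<le> 3 * l * norm e1 + 3 * l * norm e + 6 * l"
        using l by linarith
      then show ?thesis using l(2) by (simp add: A_def algebra_simps)
    qed
    finally have "norm ((\<tau> - l / 2) *\<^sub>R e1 + u *\<^sub>R e + w) \<le> R" .
    moreover have "x0 - (p + \<tau> *\<^sub>R e1 + u *\<^sub>R e + w) = - ((\<tau> - l / 2) *\<^sub>R e1 + u *\<^sub>R e + w)"
      by (simp add: p_def algebra_simps)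
    ultimately show ?thesis by (simp only: U_def mem_cball dist_norm norm_minus_cancel)
  qed
  have Ur: "dist x x0 < r" "dist x x0 < \<rho> / 2" if "x \<in> U" for x
    using that R by (auto simp: U_def dist_commute)
  have pU: "p \<in> U" "x0 \<in> U" "p + l *\<^sub>R e1 \<in> U"
    using inU[of 0 0 0] inU[of l 0 0] R l by (auto simp: U_def)
  have mono: "\<phi> (\<alpha>0, x) < \<phi> (\<alpha>0, x + u *\<^sub>R e1)" if "u > 0" "x \<in> U" "x + u *\<^sub>R e1 \<in> U" for x u
  proof (rule \<phi>_le_along(2))
    show "(\<alpha>0, x) \<in> D" "(\<alpha>0, x + u *\<^sub>R e1) \<in> D" using that Ur r by auto
    fix z assume "z \<in> closed_segment x (x + u *\<^sub>R e1)"
    then have "z \<in> U" using closed_segment_subset[OF that(2,3) U(2)] by blast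
    then show "G (\<alpha>0, z) \<bullet> e1 > 0" using r Ur by auto
  qed (use that in auto)
  have x0p: "x0 = p + (l / 2) *\<^sub>R e1" by (simp add: p_def)
  have "\<phi> (\<alpha>0, p) < \<phi> (\<alpha>0, x0)" using mono[of "l / 2" p] pU l x0p by auto
  moreover have "l *\<^sub>R e1 = (l / 2) *\<^sub>R e1 + (l / 2) *\<^sub>R e1"
    by (simp flip: scaleR_add_left)
  then have pl: "p + l *\<^sub>R e1 = x0 + (l / 2) *\<^sub>R e1"
    by (simp add: p_def)
  then have "\<phi> (\<alpha>0, x0) < \<phi> (\<alpha>0, p + l *\<^sub>R e1)" using mono[of "l / 2" x0] pU l by auto
  moreover have "(\<alpha>0, p) \<in> D" "(\<alpha>0, p + l *\<^sub>R e1) \<in> D" using pU Ur r by auto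
  ultimately obtain s where s: "s > 0"
    "\<And>\<alpha> t. \<bar>\<alpha> - \<alpha>0\<bar> < s \<Longrightarrow> \<bar>t - \<phi> (\<alpha>0, x0)\<bar> < s \<Longrightarrow> \<phi> (\<alpha>, p) < t \<and> t < \<phi> (\<alpha>, p + l *\<^sub>R e1)"
    using between_stable by metis
  define N where "N = {\<alpha>0 - min s r<..<\<alpha>0 + min s r} \<times> {\<phi> (\<alpha>0, x0) - s<..<\<phi> (\<alpha>0, x0) + s}"
  have N: "\<bar>\<alpha> - \<alpha>0\<bar> < s" "\<bar>\<alpha> - \<alpha>0\<bar> < r" "\<bar>t - \<phi> (\<alpha>0, x0)\<bar> < s" if "(\<alpha>, t) \<in> N" for \<alpha> t
    using that by (auto simp: N_def)
  show ?thesis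
  proof (rule that[of N U])
    show "open N" by (auto simp: N_def intro!: open_Times)
    show "(\<alpha>0, \<phi> (\<alpha>0, x0)) \<in> N" using s r by (auto simp: N_def)
    show "compact U" by fact
    show "U \<subseteq> V" using v R by (auto simp: U_def)
    show "(\<alpha>, x) \<in> D" if "(\<alpha>, t) \<in> N" "x \<in> U" for \<alpha> t x
      using N[OF that(1)] Ur[OF that(2)] r by auto
  next
    fix M \<epsilon> :: real assume M: "0 \<le> M" and \<epsilon>: "0 < \<epsilon>"
    \<comment> \<open>Including boundary points of \<open>D\<close> makes this set compact.
      Continuity of \<open>G\<close> up to the closure then yields a uniform bound and uniform
      continuity.\<close>
    define Z where "Z = closure D \<inter> ({-M..M} \<times> U)"
    have Z: "compact Z" unfolding Z_def by (intro closed_Int_compact compact_Times U) auto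
    have contZ: "continuous_on Z G" using cont_G by (rule continuous_on_subset) (auto simp: Z_def)
    have DZ: "(\<alpha>, x) \<in> Z" if "(\<alpha>, x) \<in> D" "x \<in> U" "\<alpha> \<in> {-M..M}" for \<alpha> x
      using that closure_subset by (auto simp: Z_def)
    obtain B where B: "B > 0" "\<And>z. z \<in> Z \<Longrightarrow> norm (G z) \<le> B"
      using compact_imp_bounded[OF compact_continuous_image[OF contZ Z]] unfolding bounded_pos by auto
    define c where "c = norm e1 + norm e + B * norm e + B * (2 + norm e)"
    have c: "c > 0"
    proof -
      have "B * (2 + norm e) > 0" "B * norm e \<ge> 0"
        using B(1) by (auto intro!: mult_pos_pos add_pos_nonneg)
      then show ?thesis unfolding c_def by (intro add_nonneg_pos) auto
    qed
    \<comment> \<open>Order of choices: \<open>n\<close> makes slab width times slice bound at most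
      \<epsilon>; \<eta> is the modulus of continuity of \<open>G\<close> for the tolerance 1/n;
      \<open>k\<close> makes the cells short compared with \<eta>.\<close>
    obtain n where n: "2 * M * (4 * c * l) / \<epsilon> < real n" using reals_Archimedean2 by blast
    have "0 \<le> 2 * M * (4 * c * l) / \<epsilon>" using M \<epsilon> c l by simp
    then have n0: "n > 0" using n by (cases n) auto
    have bound: "2 * M * (4 * c * l / n) \<le> \<epsilon>" using n n0 \<epsilon> by (simp add: field_simps)
    obtain \<eta> where \<eta>: "\<eta> > 0" "\<And>z z'. z \<in> Z \<Longrightarrow> z' \<in> Z \<Longrightarrow> dist z' z < \<eta> \<Longrightarrow> dist (G z') (G z) < 1 / n"
      using compact_uniformly_continuous[OF contZ Z] n0 unfolding uniformly_continuous_on_def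
      by (metis of_nat_0_less_iff zero_less_divide_1_iff)
    obtain k where k: "A * l / \<eta> < real k" using reals_Archimedean2 by blast
    have "0 \<le> A * l / \<eta>" using A l \<eta> by simp
    then have k0: "k > 0" using k by (cases k) auto
    define \<delta> where "\<delta> = l / k"
    have \<delta>: "\<delta> > 0" "\<delta> \<le> l" using l k0 by (auto simp: \<delta>_def divide_le_eq)
    have \<delta>n: "0 < \<delta> / real n ^ n" "\<delta> / real n ^ n \<le> \<delta>"
      using \<delta> n0 by (auto simp: divide_le_eq)
    have A\<delta>: "A * \<delta> < \<eta>" using k k0 \<eta> by (simp add: \<delta>_def field_simps)
    let ?K = "blind p e1 e \<delta> n"
    have KU: "x \<in> U" if "0 \<le> \<tau>" "\<tau> \<le> 2 * l" "dist x (?K \<tau>) < \<delta> / real n ^ n" for x \<tau>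
    proof -
      have "norm (x - ?K \<tau>) \<le> l" using that \<delta> \<delta>n by (simp add: dist_norm)
      then have "p + \<tau> *\<^sub>R e1 + sawtooth \<delta> n \<tau> *\<^sub>R e + (x - ?K \<tau>) \<in> U"
        using sawtooth_bounds[OF \<delta>(1) n0, of \<tau>] \<delta> that by (intro inU) auto
      then show ?thesis by (simp add: blind_def)
    qed
    define W where "W = {x. \<exists>\<tau>\<in>{0..l}. dist x (?K \<tau>) < \<delta> / real n ^ n}"
    have W_UN: "W = (\<Union>\<tau>\<in>{0..l}. ball (?K \<tau>) (\<delta> / real n ^ n))"
      by (auto simp: W_def dist_commute)
    have openW: "open W" unfolding W_UN by auto
    have WU: "W \<subseteq> U" using KU l by (auto simp: W_def)
    show "\<exists>W. open W \<and> W \<subseteq> U \<and> (\<forall>\<alpha> t. (\<alpha>, t) \<in> N \<longrightarrow> (\<exists>x\<in>W. (\<alpha>, x) \<in> D \<and> \<phi> (\<alpha>, x) = t))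
       \<and> emeasure lborel ((curves W - Q) \<inter> ({-M..M} \<times> UNIV)) \<le> ennreal \<epsilon>"
    proof (intro exI[of _ W] conjI allI impI openW WU)
      fix \<alpha> t assume at: "(\<alpha>, t) \<in> N"
      have "\<exists>\<tau>\<in>{0..l}. \<phi> (\<alpha>, ?K \<tau>) = t"
      proof (rule blind_covers[OF \<delta> n0 U])
        show "(\<alpha>, z) \<in> D" "G (\<alpha>, z) \<bullet> e > 0" if "z \<in> U" for z
          using r(2)[OF N(2)[OF at] Ur(1)[OF that]] by auto
        show "p + \<tau> *\<^sub>R e1 + u *\<^sub>R e \<in> U" if "0 \<le> \<tau>" "\<tau> \<le> l" "0 \<le> u" "u \<le> 2 * l" for \<tau> u
          using inU[of \<tau> u 0] that l by auto
        show "\<phi> (\<alpha>, p) \<le> t" "t \<le> \<phi> (\<alpha>, p + l *\<^sub>R e1)"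
          using s(2)[OF N(1,3)[OF at]] by auto
      qed
      then obtain \<tau> where \<tau>: "\<tau> \<in> {0..l}" "\<phi> (\<alpha>, ?K \<tau>) = t" by blast
      then have "?K \<tau> \<in> W"
        unfolding W_def mem_Collect_eq using \<delta>n(1) by (intro bexI[of _ \<tau>]) simp_all
      moreover have "(\<alpha>, ?K \<tau>) \<in> D" using calculation WU r(2)[OF N(2)[OF at]] Ur(1) by blast
      ultimately show "\<exists>x\<in>W. (\<alpha>, x) \<in> D \<and> \<phi> (\<alpha>, x) = t" using \<tau>(2) by blast
    next
      let ?X = "(curves W - Q) \<inter> ({-M..M} \<times> UNIV)"
      have "emeasure lborel ?X \<le> ennreal (2 * M * (4 * c * l / n))"
      proof (rule emeasure_le_of_thin_slices)
        have "closed ({-M..M} \<times> (UNIV :: real set))" by (intro closed_Times) auto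
        then show "?X \<in> sets borel"
          using open_curves[OF openW] Q(1) by (intro sets.Int sets.Diff borel_open borel_closed)
        show "0 \<le> 4 * c * l / real n" using c l by simp
      next
        fix \<alpha> assume \<alpha>: "\<alpha> \<in> {-M..M}"
        show "thin (4 * c * l / n) (Pair \<alpha> -` ?X)"
        proof (cases "\<bar>\<alpha> - \<alpha>0\<bar> < \<rho> / 2")
          case True
          have "(\<alpha>, \<phi> (\<alpha>, x)) \<in> Q" if "x \<in> W" for x
          proof -
            have "dist (\<alpha>, x) (\<alpha>0, x0) \<le> dist \<alpha> \<alpha>0 + dist x x0"
              unfolding dist_Pair_Pair by (rule sqrt_sum_squares_le_sum) auto
            also have "\<dots> < \<rho>" using True Ur(2)[of x] that WU by (auto simp: dist_real_def)
            finally show ?thesis using \<rho>(2)[of "(\<alpha>, x)"] by simp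
          qed
          then have "Pair \<alpha> -` ?X = {}" by (auto simp: curves_def)
          then show ?thesis by simp
        next
          case False
          have "thin (4 * c * l / n) ((\<lambda>x. \<phi> (\<alpha>, x)) ` (W \<inter> slice D \<alpha>))"
            unfolding W_def c_def \<delta>_def
          proof (rule thin_shadow_of_blind[OF l(1) k0 n0 U(2)], goal_cases)
            case (1 x \<tau>) then show ?case using KU[of \<tau> x] by (simp add: \<delta>_def)
          next
            case (2 x) then show ?case using sign[of \<alpha> x] Ur(1) False by auto
          next
            case 3 then show ?case using B by simp
          next
            case (4 x) then show ?case using B(2) DZ \<alpha> by blast
          next
            case (5 x y)
            have "dist (\<alpha>, x) (\<alpha>, y) < \<eta>"
              using 5(5) A\<delta> by (simp add: dist_Pair_Pair A_def \<delta>_def)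
            then have "dist (G (\<alpha>, x)) (G (\<alpha>, y)) < 1 / n"
              using \<eta>(2) DZ 5 \<alpha> by blast
            then show ?case by (simp add: dist_norm)
          qed
          moreover have "Pair \<alpha> -` ?X \<subseteq> (\<lambda>x. \<phi> (\<alpha>, x)) ` (W \<inter> slice D \<alpha>)"
            by (auto simp: curves_def slice_def)
          ultimately show ?thesis unfolding thin_def by (meson order_trans)
        qed
      qed (use M in auto)
      also have "\<dots> \<le> ennreal \<epsilon>" using bound by (rule ennreal_leI)
      finally show "emeasure lborel ?X \<le> ennreal \<epsilon>" .
    qed
  qed
qed

end

subsection \<open>Iteration\<close>

text \<open>Along an enumeration of \<open>I\<close>, the k-th member is allowed the error
  \<open>\<epsilon> / 2 ^ (k + 1)\<close>, and countable subadditivity sums these to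
  \<epsilon>.\<close>

lemma choose_family_small_union:
  fixes m :: "'i \<Rightarrow> 'x \<Rightarrow> 'b set"
  assumes I: "countable I" and \<epsilon>: "0 < \<epsilon>"
    and ex: "\<And>i \<epsilon>. i \<in> I \<Longrightarrow> 0 < \<epsilon> \<Longrightarrow> \<exists>x. P i x \<and> m i x \<in> sets M \<and> emeasure M (m i x) \<le> ennreal \<epsilon>"
  shows "\<exists>X. (\<forall>i\<in>I. P i (X i)) \<and> emeasure M (\<Union>i\<in>I. m i (X i)) \<le> ennreal \<epsilon>"
proof -
  define \<epsilon>' where "\<epsilon>' k = \<epsilon> * (1 / 2) ^ Suc k" for k
  have \<epsilon>': "\<epsilon>' k > 0" for k using \<epsilon> by (simp add: \<epsilon>'_def)
  have "\<forall>i\<in>I. \<exists>x. P i x \<and> m i x \<in> sets M \<and> emeasure M (m i x) \<le> ennreal (\<epsilon>' (to_nat_on I i))"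
    using ex \<epsilon>' by blast
  from bchoice[OF this]
  obtain X where X: "\<And>i. i \<in> I \<Longrightarrow> P i (X i) \<and> m i (X i) \<in> sets M \<and> emeasure M (m i (X i)) \<le> ennreal (\<epsilon>' (to_nat_on I i))"
    by blast
  \<comment> \<open>\<open>I\<close> may be finite, so numbers that enumerate nothing receive the
    empty set.\<close>
  define Y where "Y k = (if k \<in> to_nat_on I ` I then m (from_nat_into I k) (X (from_nat_into I k)) else {})" for k
  have Y_in: "from_nat_into I k \<in> I" "to_nat_on I (from_nat_into I k) = k" if "k \<in> to_nat_on I ` I" for k
    using that I by auto
  have Y: "Y k \<in> sets M" "emeasure M (Y k) \<le> ennreal (\<epsilon>' k)" for k
    using X[OF Y_in(1)[of k]] Y_in(2)[of k] by (auto simp: Y_def)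
  have "(\<Union>i\<in>I. m i (X i)) = (\<Union>k. Y k)"
    using I by (force simp: Y_def)
  also have "emeasure M \<dots> \<le> (\<Sum>k. emeasure M (Y k))"
    using Y by (intro emeasure_subadditive_countably) auto
  also have "\<dots> \<le> (\<Sum>k. ennreal (\<epsilon>' k))"
    using Y by (intro suminf_le) auto
  also have "\<dots> = ennreal \<epsilon>"
    using sums_mult[OF power_half_series, of \<epsilon>] \<epsilon>
    by (intro suminf_ennreal_eq) (auto simp: \<epsilon>'_def)
  finally show ?thesis using X by blast
qed

section \<open>The tree of coverings and its limit set\<close>

context phase_function
begin

text \<open>
  A node \<open>(N, W)\<close> of the tree records that the curves of the points of \<open>W\<close> cover \<open>N \<inter> F\<close>. The compact set
  between a node and its child makes the sets \<open>W\<close> along a branch have a common point whose curve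
  passes through \<open>q\<close>.
\<close>

definition covering :: "(real \<times> real) set \<Rightarrow> (real \<times> real) set \<times> (real^2) set \<Rightarrow> bool" where
  "covering F = (\<lambda>(N, W). open W \<and> (\<forall>\<alpha> t. (\<alpha>, t) \<in> N \<inter> F \<longrightarrow> (\<exists>x\<in>W. (\<alpha>, x) \<in> D \<and> \<phi> (\<alpha>, x) = t)))"

definition child :: "real \<times> real \<Rightarrow> (real \<times> real) set \<times> (real^2) set \<Rightarrow> (real \<times> real) set \<times> (real^2) set \<Rightarrow> bool" where
  "child q = (\<lambda>(N, W) (N', W'). q \<in> N' \<and> (\<exists>C. compact C \<and> W' \<subseteq> C \<and> C \<subseteq> W \<and> (\<forall>x\<in>C. (fst q, x) \<in> D)))"

text \<open>The slab is needed because blinds control each slice by a fixed bound, which is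
  integrable only over bounded ranges of \<alpha>.\<close>

definition excess :: "(real \<times> real) set \<Rightarrow> real \<Rightarrow> (real^2) set \<Rightarrow> (real \<times> real) set" where
  "excess Q M W = (curves W - Q) \<inter> ({-M..M} \<times> UNIV)"

lemma excess_UN: "excess Q M (\<Union>i\<in>I. W i) = (\<Union>i\<in>I. excess Q M (W i))"
  by (auto simp: excess_def curves_UN)

lemma excess_borel: "open Q \<Longrightarrow> open W \<Longrightarrow> excess Q M W \<in> sets borel"
  unfolding excess_def
  by (intro sets.Int sets.Diff borel_open borel_closed open_curves closed_Times) auto

text \<open>Every \<open>q\<close> in \<open>N \<inter> F\<close> lies on the curve of some point of
  \<open>W\<close>, around which \<open>efficient_local_cover\<close> provides a neighbourhood and a
  compact set valid for every error. Lindelof's theorem leaves countably many neighbourhoods; the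
  errors are then distributed by \<open>choose_family_small_union\<close>.\<close>

lemma refine_single:
  assumes cov: "covering F (N, W)" and Q: "open Q" "F \<subseteq> Q" and M: "0 \<le> M" and \<epsilon>: "0 < \<epsilon>"
  shows "\<exists>S. (countable S \<and> (\<forall>c\<in>S. covering F c) \<and> (\<forall>q\<in>N \<inter> F. \<exists>c\<in>S. child q (N, W) c))
    \<and> excess Q M (\<Union>(snd ` S)) \<in> sets lborel \<and> emeasure lborel (excess Q M (\<Union>(snd ` S))) \<le> ennreal \<epsilon>"
proof -
  have "\<exists>N' C. open N' \<and> q \<in> N' \<and> compact C \<and> C \<subseteq> W \<and> (\<forall>\<alpha> t x. (\<alpha>, t) \<in> N' \<longrightarrow> x \<in> C \<longrightarrow> (\<alpha>, x) \<in> D)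
     \<and> (\<forall>\<epsilon>>0. \<exists>W'. (W' \<subseteq> C \<and> covering F (N', W')) \<and> excess Q M W' \<in> sets lborel \<and> emeasure lborel (excess Q M W') \<le> ennreal \<epsilon>)"
    if q: "q \<in> N \<inter> F" for q
  proof -
    obtain \<alpha> t where at: "q = (\<alpha>, t)" by (cases q)
    obtain x where x: "x \<in> W" "(\<alpha>, x) \<in> D" "\<phi> (\<alpha>, x) = t"
      using cov q unfolding covering_def at by blast
    have W: "open W" using cov by (simp add: covering_def)
    have qQ: "(\<alpha>, \<phi> (\<alpha>, x)) \<in> Q" using q Q(2) at x by auto
    obtain N' C where NC: "open N'" "(\<alpha>, \<phi> (\<alpha>, x)) \<in> N'" "compact C" "C \<subseteq> W"
      "\<And>\<alpha> t x. (\<alpha>, t) \<in> N' \<Longrightarrow> x \<in> C \<Longrightarrow> (\<alpha>, x) \<in> D"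
      "\<And>M \<epsilon>. 0 \<le> M \<Longrightarrow> 0 < \<epsilon> \<Longrightarrow> \<exists>W. open W \<and> W \<subseteq> C \<and> (\<forall>\<alpha> t. (\<alpha>, t) \<in> N' \<longrightarrow> (\<exists>x\<in>W. (\<alpha>, x) \<in> D \<and> \<phi> (\<alpha>, x) = t))
       \<and> emeasure lborel ((curves W - Q) \<inter> ({-M..M} \<times> UNIV)) \<le> ennreal \<epsilon>"
      using efficient_local_cover[OF x(2) W x(1) Q(1) qQ] by blast
    have "\<exists>W'. (W' \<subseteq> C \<and> covering F (N', W')) \<and> excess Q M W' \<in> sets lborel \<and> emeasure lborel (excess Q M W') \<le> ennreal \<epsilon>"
      if eps: "\<epsilon> > 0" for \<epsilon>
    proof -
      obtain W' where "open W'" "W' \<subseteq> C" "\<forall>\<alpha> t. (\<alpha>, t) \<in> N' \<longrightarrow> (\<exists>x\<in>W'. (\<alpha>, x) \<in> D \<and> \<phi> (\<alpha>, x) = t)"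
        "emeasure lborel ((curves W' - Q) \<inter> ({-M..M} \<times> UNIV)) \<le> ennreal \<epsilon>"
        using NC(6)[OF M eps] by blast
      then show ?thesis
        using excess_borel[OF Q(1), of W' M] by (intro exI[of _ W']) (auto simp: covering_def excess_def)
    qed
    with NC at x show ?thesis by blast
  qed
  then obtain n c where nc: "\<And>q. q \<in> N \<inter> F \<Longrightarrow> open (n q) \<and> q \<in> n q \<and> compact (c q) \<and> c q \<subseteq> W
     \<and> (\<forall>\<alpha> t x. (\<alpha>, t) \<in> n q \<longrightarrow> x \<in> c q \<longrightarrow> (\<alpha>, x) \<in> D)
     \<and> (\<forall>\<epsilon>>0. \<exists>W'. (W' \<subseteq> c q \<and> covering F (n q, W')) \<and> excess Q M W' \<in> sets lborel \<and> emeasure lborel (excess Q M W') \<le> ennreal \<epsilon>)"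
    by metis
  have op: "open B" if "B \<in> n ` (N \<inter> F)" for B using that nc by blast
  obtain \<G> where \<G>: "\<G> \<subseteq> n ` (N \<inter> F)" "countable \<G>" "\<Union>\<G> = \<Union>(n ` (N \<inter> F))"
    using Lindelof[of "n ` (N \<inter> F)", OF op] by blast
  then obtain I where I: "I \<subseteq> N \<inter> F" "countable I" "\<G> = n ` I"
    using countable_subset_image[of \<G> n "N \<inter> F"] by blast
  have ex: "\<exists>W'. (W' \<subseteq> c q \<and> covering F (n q, W')) \<and> excess Q M W' \<in> sets lborel \<and> emeasure lborel (excess Q M W') \<le> ennreal \<epsilon>"
    if q: "q \<in> I" and eps: "\<epsilon> > 0" for q \<epsilon>
    using nc[OF subsetD[OF I(1) q]] eps by blast
  have "\<exists>X. (\<forall>q\<in>I. X q \<subseteq> c q \<and> covering F (n q, X q))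
    \<and> emeasure lborel (\<Union>q\<in>I. excess Q M (X q)) \<le> ennreal \<epsilon>"
    by (rule choose_family_small_union[OF I(2) \<epsilon>]) (rule ex)
  then obtain X where X: "\<forall>q\<in>I. X q \<subseteq> c q \<and> covering F (n q, X q)"
    "emeasure lborel (\<Union>q\<in>I. excess Q M (X q)) \<le> ennreal \<epsilon>"
    by (elim exE conjE)
  define S where "S = (\<lambda>q. (n q, X q)) ` I"
  have US: "\<Union>(snd ` S) = (\<Union>q\<in>I. X q)" by (simp add: S_def image_image)
  have "open (X q)" if "q \<in> I" for q using X(1) that by (auto simp: covering_def)
  then have "open (\<Union>q\<in>I. X q)" by blast
  then have meas: "excess Q M (\<Union>(snd ` S)) \<in> sets lborel"
    unfolding US using excess_borel[OF Q(1)] by simp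
  have "\<exists>c\<in>S. child q (N, W) c" if q: "q \<in> N \<inter> F" for q
  proof -
    have "q \<in> \<Union>\<G>" using \<G>(3) nc q by blast
    then obtain q' where q': "q' \<in> I" "q \<in> n q'" using I(3) by blast
    moreover have "(fst q, x) \<in> D" if "x \<in> c q'" for x
      using nc[of q'] q' I(1) that by (metis prod.collapse subsetD)
    moreover have "compact (c q')" "c q' \<subseteq> W" "X q' \<subseteq> c q'"
      using nc[of q'] X(1) q' I(1) by blast+
    ultimately have "child q (N, W) (n q', X q')"
      unfolding child_def prod.case by blast
    then show ?thesis using q' by (auto simp: S_def)
  qed
  moreover have "countable S" "\<forall>c\<in>S. covering F c" using I(2) X(1) by (auto simp: S_def)
  ultimately show ?thesis
    using meas X(2) US excess_UN[of Q M X I] by (intro exI[of _ S]) simp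
qed

lemma refine_family:
  assumes S: "countable S" "\<And>c. c \<in> S \<Longrightarrow> covering F c" and Q: "open Q" "F \<subseteq> Q" and M: "0 \<le> M" and \<epsilon>: "0 < \<epsilon>"
  obtains S' where "countable S'" "\<And>c. c \<in> S' \<Longrightarrow> covering F c"
    "\<And>c q. c \<in> S \<Longrightarrow> q \<in> fst c \<inter> F \<Longrightarrow> \<exists>c'\<in>S'. child q c c'"
    "emeasure lborel (excess Q M (\<Union>(snd ` S'))) \<le> ennreal \<epsilon>"
proof -
  have ex: "\<exists>T. (countable T \<and> (\<forall>c\<in>T. covering F c) \<and> (\<forall>q\<in>fst c \<inter> F. \<exists>c'\<in>T. child q c c'))
    \<and> excess Q M (\<Union>(snd ` T)) \<in> sets lborel \<and> emeasure lborel (excess Q M (\<Union>(snd ` T))) \<le> ennreal \<epsilon>"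
    if "c \<in> S" "\<epsilon> > 0" for c \<epsilon>
    using refine_single[of F "fst c" "snd c" Q M \<epsilon>] S(2)[OF that(1)] Q M that(2) by simp
  have "\<exists>T. (\<forall>c\<in>S. countable (T c) \<and> (\<forall>c\<in>T c. covering F c) \<and> (\<forall>q\<in>fst c \<inter> F. \<exists>c'\<in>T c. child q c c'))
    \<and> emeasure lborel (\<Union>c\<in>S. excess Q M (\<Union>(snd ` T c))) \<le> ennreal \<epsilon>"
    by (rule choose_family_small_union[OF S(1) \<epsilon>]) (rule ex)
  then obtain T where T: "\<forall>c\<in>S. countable (T c) \<and> (\<forall>c\<in>T c. covering F c) \<and> (\<forall>q\<in>fst c \<inter> F. \<exists>c'\<in>T c. child q c c')"
    "emeasure lborel (\<Union>c\<in>S. excess Q M (\<Union>(snd ` T c))) \<le> ennreal \<epsilon>"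
    by (elim exE conjE)
  have eq: "\<Union>(snd ` (\<Union>c\<in>S. T c)) = (\<Union>c\<in>S. \<Union>(snd ` T c))" by blast
  show ?thesis
  proof (rule that[of "\<Union>c\<in>S. T c"])
    show "emeasure lborel (excess Q M (\<Union>(snd ` (\<Union>c\<in>S. T c)))) \<le> ennreal \<epsilon>"
      unfolding eq excess_UN[of Q M "\<lambda>c. \<Union>(snd ` T c)" S] by (rule T(2))
  qed (use S(1) T(1) in \<open>blast+\<close>)
qed

text \<open>The root of the tree is the whole plane, and stage \<open>n\<close> refines inside
  \<open>Q n\<close> up to excess \<open>1 / 2 ^ n\<close> in the slab of half-width
  \<open>n\<close>. A point \<open>q\<close> of \<open>F\<close> selects a branch; the nested
  compact sets along it contain a point of \<open>E\<close> whose curve passes through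
  \<open>q\<close>.\<close>

lemma exists_efficient_cover:
  assumes F: "\<And>\<alpha> t. (\<alpha>, t) \<in> F \<Longrightarrow> \<exists>x. (\<alpha>, x) \<in> D \<and> \<phi> (\<alpha>, x) = t"
    and Q: "\<And>n. open (Q n)" "\<And>n. F \<subseteq> Q n"
  obtains E where "E \<in> sets borel" "F \<subseteq> curves E"
    "\<And>n. \<exists>W. open W \<and> E \<subseteq> W \<and> emeasure lborel (excess (Q n) (real n) W) \<le> ennreal ((1 / 2) ^ n)"
proof -
  define ok where "ok n S \<longleftrightarrow> countable S \<and> (\<forall>c\<in>S. covering F c) \<and> (n = 0 \<longrightarrow> S = {(UNIV, UNIV)})" for n :: nat and S
  define step where "step n S S' \<longleftrightarrow> (\<forall>c\<in>S. \<forall>q\<in>fst c \<inter> F. \<exists>c'\<in>S'. child q c c')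
    \<and> emeasure lborel (excess (Q n) (real n) (\<Union>(snd ` S'))) \<le> ennreal ((1 / 2) ^ n)" for n S S'
  have "\<exists>S. \<forall>n. ok n (S n) \<and> step n (S n) (S (Suc n))"
  proof (rule dependent_nat_choice)
    show "\<exists>S. ok 0 S"
      using F by (intro exI[of _ "{(UNIV, UNIV)}"]) (auto simp: ok_def covering_def)
    fix S n assume "ok n S"
    then obtain S' where "countable S'" "\<And>c. c \<in> S' \<Longrightarrow> covering F c"
      "\<And>c q. c \<in> S \<Longrightarrow> q \<in> fst c \<inter> F \<Longrightarrow> \<exists>c'\<in>S'. child q c c'"
      "emeasure lborel (excess (Q n) (real n) (\<Union>(snd ` S'))) \<le> ennreal ((1 / 2) ^ n)"
      using refine_family[of S F "Q n" "real n" "(1 / 2) ^ n"] Q unfolding ok_def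
      by (metis of_nat_0_le_iff half_gt_zero zero_less_one zero_less_power)
    then show "\<exists>S'. ok (Suc n) S' \<and> step n S S'" by (intro exI[of _ S']) (auto simp: ok_def step_def)
  qed
  then obtain S where S: "\<And>n. ok n (S n)" "\<And>n. step n (S n) (S (Suc n))" by blast
  define W where "W n = \<Union>(snd ` S n)" for n
  have W: "open (W n)" for n
    unfolding W_def
  proof (rule open_Union, clarify)
    fix N B assume "(N, B) \<in> S n"
    then have "covering F (N, B)" using S(1)[of n] by (auto simp: ok_def)
    then show "open (snd (N, B))" by (simp add: covering_def)
  qed
  \<comment> \<open>Level 0 is the whole plane and carries no measure bound; the bound of stage
    \<open>n\<close> concerns level \<open>Suc n\<close>.\<close>
  define E where "E = (\<Inter>n. W (Suc n))"
  show ?thesis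
  proof (rule that[of E])
    show "E \<in> sets borel" unfolding E_def using W by (intro sets.countable_INT) auto
    show "\<exists>W. open W \<and> E \<subseteq> W \<and> emeasure lborel (excess (Q n) (real n) W) \<le> ennreal ((1 / 2) ^ n)" for n
      using W S(2)[of n] by (intro exI[of _ "W (Suc n)"]) (auto simp: E_def W_def step_def)
    show "F \<subseteq> curves E"
    proof
      fix q assume q: "q \<in> F"
      have "\<exists>c. \<forall>n. (c n \<in> S n \<and> q \<in> fst (c n)) \<and> child q (c n) (c (Suc n))"
      proof (rule dependent_nat_choice)
        show "\<exists>c. c \<in> S 0 \<and> q \<in> fst c" using S(1)[of 0] by (auto simp: ok_def)
        fix c n assume "c \<in> S n \<and> q \<in> fst c"
        then obtain c' where "c' \<in> S (Suc n)" "child q c c'"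
          using S(2)[of n] q unfolding step_def by blast
        then show "\<exists>c'. (c' \<in> S (Suc n) \<and> q \<in> fst c') \<and> child q c c'"
          by (intro exI[of _ c']) (auto simp: child_def split: prod.splits)
      qed
      then obtain c where c: "\<And>n. c n \<in> S n" "\<And>n. q \<in> fst (c n)" "\<And>n. child q (c n) (c (Suc n))" by blast
      have "\<exists>C. compact C \<and> snd (c (Suc n)) \<subseteq> C \<and> C \<subseteq> snd (c n) \<and> (\<forall>x\<in>C. (fst q, x) \<in> D)" for n
        using c(3)[of n] by (auto simp: child_def split: prod.splits)
      then obtain C where C: "\<And>n. compact (C n)" "\<And>n. snd (c (Suc n)) \<subseteq> C n" "\<And>n. C n \<subseteq> snd (c n)"
        "\<And>n x. x \<in> C n \<Longrightarrow> (fst q, x) \<in> D" by metis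
      \<comment> \<open>Nonempty because the node at level \<open>Suc n\<close> covers
        \<open>q\<close> by a point of its open set, which is contained in \<open>C n\<close>;
        compact because \<phi> is continuous on the slice over \<open>C n\<close>.\<close>
      define K where "K n = {x \<in> C n. \<phi> (fst q, x) = snd q}" for n
      have "\<Inter>(range K) \<noteq> {}"
      proof (rule compact_nest)
        fix n
        have "continuous_on (C n) (\<lambda>x. \<phi> (fst q, x))"
          by (rule continuous_on_compose2[OF cont_\<phi>]) (auto intro!: continuous_intros C(4))
        then have "closed (C n \<inter> (\<lambda>x. \<phi> (fst q, x)) -` {snd q})"
          using C(1) by (intro continuous_closed_preimage compact_imp_closed) auto
        moreover have "K n = C n \<inter> (C n \<inter> (\<lambda>x. \<phi> (fst q, x)) -` {snd q})" by (auto simp: K_def)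
        ultimately show "compact (K n)" using C(1) by (metis compact_Int_closed)
        have "covering F (c (Suc n))" using S(1) c(1) by (auto simp: ok_def)
        then obtain x where "x \<in> snd (c (Suc n))" "\<phi> (fst q, x) = snd q"
          using q c(2)[of "Suc n"] unfolding covering_def by (cases q) (auto split: prod.splits)
        then show "K n \<noteq> {}" using C(2) by (auto simp: K_def)
      next
        fix m n :: nat assume "m \<le> n"
        then show "K n \<subseteq> K m"
        proof (induction rule: dec_induct)
          case (step i)
          have "C (Suc i) \<subseteq> C i" using C(2)[of i] C(3)[of "Suc i"] by blast
          then show ?case using step by (auto simp: K_def)
        qed simp
      qed
      then obtain x where x: "\<And>n. x \<in> K n" by blast
      have "x \<in> snd (c (Suc n))" for n using x[of "Suc n"] C(3)[of "Suc n"] by (auto simp: K_def)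
      then have "x \<in> E" using c(1) by (fastforce simp: E_def W_def)
      moreover have "(fst q, x) \<in> D" "\<phi> (fst q, x) = snd q" using x[of 0] C(4) by (auto simp: K_def)
      ultimately show "q \<in> curves E" unfolding curves_def by (cases q) auto
    qed
  qed
qed

end

subsection \<open>Null sets, gradients and angles\<close>

text \<open>The n-th estimate reaches only up to \<bar>\<alpha>\<bar> \<le> n, so on a fixed slab
  the bounds hold from some \<open>n\<close> on. They tend to 0, and countably many slabs exhaust
  the plane.\<close>

lemma negligible_if_eventually_small:
  fixes Z :: "(real \<times> real) set"
  assumes "\<And>m::nat. \<forall>\<^sub>F n in sequentially. \<exists>T\<in>sets lebesgue. Z \<inter> ({-real m..real m} \<times> UNIV) \<subseteq> T
     \<and> emeasure lebesgue T \<le> ennreal (2 * (1 / 2) ^ n)"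
  shows "negligible Z"
proof -
  have "negligible (Z \<inter> ({-real m..real m} \<times> UNIV))" for m
    unfolding negligible_outer
  proof (intro allI impI)
    fix e :: real assume e: "e > 0"
    have "(\<lambda>n. 2 * (1 / 2) ^ n :: real) \<longlonglongrightarrow> 2 * 0"
      by (intro tendsto_intros LIMSEQ_power_zero) auto
    then have "\<forall>\<^sub>F n in sequentially. 2 * (1 / 2) ^ n < e"
      using e by (intro order_tendstoD(2)) auto
    from eventually_happens'[OF sequentially_bot eventually_conj[OF this assms[of m]]]
    obtain n T where T: "2 * (1 / 2) ^ n < e" "T \<in> sets lebesgue" "Z \<inter> ({-real m..real m} \<times> UNIV) \<subseteq> T"
      "emeasure lebesgue T \<le> ennreal (2 * (1 / 2) ^ n)" by blast
    have "T \<in> lmeasurable" using T(2,4) by (intro fmeasurableI) (auto intro: le_less_trans)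
    moreover have "measure lebesgue T \<le> 2 * (1 / 2) ^ n"
      using T(4) by (simp add: measure_def enn2real_leI)
    ultimately show "\<exists>T. Z \<inter> ({-real m..real m} \<times> UNIV) \<subseteq> T \<and> T \<in> lmeasurable \<and> measure lebesgue T < e"
      using T by (intro exI[of _ T]) auto
  qed
  then have "negligible (\<Union>m. Z \<inter> ({-real m..real m} \<times> UNIV))"
    by (intro negligible_countable_Union) auto
  moreover have "Z \<subseteq> (\<Union>m. Z \<inter> ({-real m..real m} \<times> UNIV))"
  proof
    fix z assume z: "z \<in> Z"
    obtain m where "\<bar>fst z\<bar> < real m" using reals_Archimedean2 by blast
    then have "z \<in> {-real m..real m} \<times> UNIV" by (cases z) auto
    with z show "z \<in> (\<Union>m. Z \<inter> ({-real m..real m} \<times> UNIV))" by blast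
  qed
  ultimately show ?thesis by (rule negligible_subset)
qed

text \<open>Fubini's theorem for a Borel null superset, whose slices contain those of
  \<open>Z\<close>.\<close>

lemma AE_slice_null:
  fixes Z :: "(real \<times> real) set"
  assumes "negligible Z"
  shows "AE \<alpha> in lebesgue. {t. (\<alpha>, t) \<in> Z} \<in> null_sets lebesgue"
proof -
  have "Z \<in> null_sets (completion lborel)" using assms by (simp add: negligible_iff_null_sets)
  then obtain N where N: "N \<in> null_sets lborel" "Z \<subseteq> N"
    unfolding null_sets_completion_iff2 by blast
  have "AE z in lborel \<Otimes>\<^sub>M lborel. z \<notin> N"
    using AE_not_in[OF N(1)] by (simp only: lborel_prod)
  then have "AE \<alpha> in lborel. AE t in lborel. (\<alpha>, t) \<notin> N"
    by (rule lborel_pair.AE_pair)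
  then have "AE \<alpha> in lborel. {t. (\<alpha>, t) \<in> Z} \<in> null_sets lebesgue"
  proof eventually_elim
    case (elim \<alpha>)
    then obtain T where "T \<in> null_sets lborel" "{t. (\<alpha>, t) \<in> N} \<subseteq> T"
      unfolding eventually_ae_filter by auto
    with N(2) show ?case unfolding null_sets_completion_iff2 by blast
  qed
  then show ?thesis by (rule AE_completion)
qed

section \<open>Gradients and tangent angles\<close>

lemma grad_x_has_derivative:
  assumes "C1_on D \<phi>" "(\<alpha>, x) \<in> D"
  shows "((\<lambda>y. \<phi> (\<alpha>, y)) has_derivative (\<lambda>v. grad_x \<phi> (\<alpha>, x) \<bullet> v)) (at x)"
proof -
  obtain f' where f': "(\<phi> has_derivative blinfun_apply (f' (\<alpha>, x))) (at (\<alpha>, x))"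
    using assms unfolding C1_on_def by blast
  have "((\<lambda>y. (\<alpha>, y)) has_derivative (\<lambda>v. (0, v))) (at x)"
    by (auto intro!: derivative_eq_intros)
  from diff_chain_at[OF this f']
  have L: "((\<lambda>y. \<phi> (\<alpha>, y)) has_derivative (\<lambda>v. f' (\<alpha>, x) (0, v))) (at x)"
    by (simp add: o_def)
  \<comment> \<open>The adjoint of a linear functional, evaluated at 1, is its Riesz
    representative.\<close>
  define g where "g = adjoint (\<lambda>v. f' (\<alpha>, x) (0, v)) 1"
  have "(\<lambda>v. f' (\<alpha>, x) (0, v)) = (\<lambda>v. v \<bullet> g)"
    using adjoint_works[OF has_derivative_linear[OF L], of _ 1] by (simp add: g_def)
  then have g: "GDERIV (\<lambda>y. \<phi> (\<alpha>, y)) x :> g"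
    using L by (simp add: gderiv_def)
  have "grad_x \<phi> (\<alpha>, x) = g"
    unfolding grad_x_def fst_conv snd_conv
  proof (rule the_equality, rule g)
    fix h assume "GDERIV (\<lambda>y. \<phi> (\<alpha>, y)) x :> h"
    then have "(\<lambda>v. v \<bullet> h) = (\<lambda>v. v \<bullet> g)"
      using g unfolding gderiv_def by (rule has_derivative_unique)
    then show "h = g" by (metis vector_eq_ldot)
  qed
  with g show ?thesis by (simp add: gderiv_def inner_commute)
qed

text \<open>(cos t, sin t) and (-sin t, cos t) form an orthonormal basis, so \<open>v\<close> is its
  own projection onto the second vector.\<close>

lemma perp_direction_decomp:
  assumes "t \<in> perp_direction v" "v \<noteq> 0"
  obtains c where "c \<noteq> 0" "v = c *\<^sub>R vector [- sin t, cos t]"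
proof -
  have perp: "cos t * v $ 1 + sin t * v $ 2 = 0"
    using assms(1) by (simp add: perp_direction_def orthogonal_def inner_real2)
  define c where "c = v $ 2 * cos t - v $ 1 * sin t"
  have sc: "sin t * sin t + cos t * cos t = 1"
    by (metis sin_cos_squared_add power2_eq_square)
  have "v $ 1 = - (c * sin t)"
  proof -
    have "- (c * sin t) = v $ 1 * (sin t * sin t) - cos t * (sin t * v $ 2)"
      by (simp add: c_def algebra_simps)
    also have "sin t * v $ 2 = - (cos t * v $ 1)" using perp by linarith
    also have "v $ 1 * (sin t * sin t) - cos t * - (cos t * v $ 1) = v $ 1 * (sin t * sin t + cos t * cos t)"
      by (simp only: distrib_left mult_minus_right diff_minus_eq_add mult_ac add_ac)
    finally show ?thesis by (simp only: sc mult_1_right)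
  qed
  moreover have "v $ 2 = c * cos t"
  proof -
    have "c * cos t = v $ 2 * (cos t * cos t) - sin t * (cos t * v $ 1)"
      by (simp add: c_def algebra_simps)
    also have "cos t * v $ 1 = - (sin t * v $ 2)" using perp by linarith
    also have "v $ 2 * (cos t * cos t) - sin t * - (sin t * v $ 2) = v $ 2 * (sin t * sin t + cos t * cos t)"
      by (simp only: distrib_left mult_minus_right diff_minus_eq_add mult_ac add_ac)
    finally show ?thesis by (simp only: sc mult_1_right)
  qed
  ultimately have "v = c *\<^sub>R vector [- sin t, cos t]"
    by (simp add: vec_eq_iff forall_2)
  with assms(2) show ?thesis by (intro that[of c]) auto
qed

text \<open>Each determinant is a product of two scalars \<open>c\<close> and the sine of an angle
  difference. The differences lie strictly between 0 and \<pi>, so the sines are positive; each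
  scalar occurs twice in the triple product, so the unknown signs cancel.\<close>

lemma angle_monotone_det2:
  assumes mono: "angle_monotone D \<phi>" and ns: "nonstationary D \<phi>"
    and D: "(\<alpha>, x) \<in> D" "(\<beta>, x) \<in> D" "(\<gamma>, x) \<in> D" and less: "\<alpha> < \<beta>" "\<beta> < \<gamma>"
  shows "det2 (grad_x \<phi> (\<alpha>, x)) (grad_x \<phi> (\<beta>, x)) * det2 (grad_x \<phi> (\<beta>, x)) (grad_x \<phi> (\<gamma>, x))
     * det2 (grad_x \<phi> (\<alpha>, x)) (grad_x \<phi> (\<gamma>, x)) > 0"
proof -
  obtain a \<theta> where \<theta>: "\<And>\<alpha>. (\<alpha>, x) \<in> D \<Longrightarrow> \<theta> \<alpha> \<in> tangent_direction \<phi> \<alpha> x \<inter> {a..<a + pi}"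
    "strict_mono_on {\<alpha>. (\<alpha>, x) \<in> D} \<theta>"
    using mono unfolding angle_monotone_def by metis
  have "\<exists>c. c \<noteq> 0 \<and> grad_x \<phi> (\<alpha>, x) = c *\<^sub>R vector [- sin (\<theta> \<alpha>), cos (\<theta> \<alpha>)]" if "(\<alpha>, x) \<in> D" for \<alpha>
    using perp_direction_decomp[of "\<theta> \<alpha>" "grad_x \<phi> (\<alpha>, x)"] \<theta>(1)[OF that] ns that
    unfolding tangent_direction_def nonstationary_def by blast
  then obtain c where c: "\<And>\<alpha>. (\<alpha>, x) \<in> D \<Longrightarrow> c \<alpha> \<noteq> 0 \<and> grad_x \<phi> (\<alpha>, x) = c \<alpha> *\<^sub>R vector [- sin (\<theta> \<alpha>), cos (\<theta> \<alpha>)]"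
    by metis
  have det: "det2 (grad_x \<phi> (\<alpha>, x)) (grad_x \<phi> (\<beta>, x)) = c \<alpha> * c \<beta> * sin (\<theta> \<beta> - \<theta> \<alpha>)"
    if "(\<alpha>, x) \<in> D" "(\<beta>, x) \<in> D" for \<alpha> \<beta>
    using c[OF that(1)] c[OF that(2)] by (simp add: det2_def sin_diff algebra_simps)
  have sin_pos: "sin (\<theta> \<beta> - \<theta> \<alpha>) > 0" if "(\<alpha>, x) \<in> D" "(\<beta>, x) \<in> D" "\<alpha> < \<beta>" for \<alpha> \<beta>
  proof (rule sin_gt_zero)
    show "0 < \<theta> \<beta> - \<theta> \<alpha>" using strict_mono_onD[OF \<theta>(2), of \<alpha> \<beta>] that by simp
    show "\<theta> \<beta> - \<theta> \<alpha> < pi" using \<theta>(1)[OF that(1)] \<theta>(1)[OF that(2)] by auto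
  qed
  have "det2 (grad_x \<phi> (\<alpha>, x)) (grad_x \<phi> (\<beta>, x)) * det2 (grad_x \<phi> (\<beta>, x)) (grad_x \<phi> (\<gamma>, x))
     * det2 (grad_x \<phi> (\<alpha>, x)) (grad_x \<phi> (\<gamma>, x))
    = (c \<alpha> * c \<beta> * c \<gamma>)\<^sup>2 * (sin (\<theta> \<beta> - \<theta> \<alpha>) * sin (\<theta> \<gamma> - \<theta> \<beta>) * sin (\<theta> \<gamma> - \<theta> \<alpha>))"
    using D by (simp add: det power2_eq_square mult_ac)
  also have "\<dots> > 0"
    using c D sin_pos[OF D(1,2) less(1)] sin_pos[OF D(2,3) less(2)] sin_pos[OF D(1,3)] less
    by (intro mult_pos_pos) auto
  finally show ?thesis .
qed

theorem theorem1p2: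
  fixes D :: "(real \<times> (real^2)) set"
    and \<phi> :: "real \<times> (real^2) \<Rightarrow> real"
    and F :: "real \<Rightarrow> real set"
  assumes "open D"
    and "C1_on D \<phi>"
    and "nonstationary D \<phi>"
    and "angle_monotone D \<phi>"
    and "\<exists>\<psi>. continuous_on (closure D) \<psi> \<and> (\<forall>p\<in>D. \<psi> p = \<phi> p)"
    and "\<exists>G. continuous_on (closure D) G \<and> (\<forall>p\<in>D. G p = grad_x \<phi> p) \<and> (\<forall>p\<in>closure D. G p \<noteq> 0)"
    and "\<forall>\<alpha>. convex (slice D \<alpha>)"
    and "\<forall>\<alpha>. F \<alpha> \<subseteq> (\<lambda>x. \<phi> (\<alpha>, x)) ` slice D \<alpha>"
    and "(\<Union>\<alpha>. {\<alpha>} \<times> F \<alpha>) \<in> sets (lebesgue :: (real \<times> real) measure)"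
  shows "\<exists>E :: (real^2) set. E \<in> sets borel \<and>
    (\<forall>\<alpha>. F \<alpha> \<subseteq> (\<lambda>x. \<phi> (\<alpha>, x)) ` (E \<inter> slice D \<alpha>)) \<and>
    (AE \<alpha> in lebesgue. (\<lambda>x. \<phi> (\<alpha>, x)) ` (E \<inter> slice D \<alpha>) - F \<alpha> \<in> null_sets lebesgue)"
proof -
  obtain G where G: "continuous_on (closure D) G" "\<And>p. p \<in> D \<Longrightarrow> G p = grad_x \<phi> p"
    using assms(6) by blast
  have cont: "continuous_on D \<phi>"
    using assms(2) has_derivative_continuous unfolding C1_on_def
    by (blast intro: continuous_at_imp_continuous_on)
  interpret phase_function D \<phi> G
  proof
    show "open D" "continuous_on D \<phi>" "continuous_on (closure D) G" by fact+
    show "convex (slice D \<alpha>)" for \<alpha> using assms(7) by blast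
    show "((\<lambda>y. \<phi> (\<alpha>, y)) has_derivative (\<lambda>v. G (\<alpha>, x) \<bullet> v)) (at x)" if "(\<alpha>, x) \<in> D" for \<alpha> x
      unfolding G(2)[OF that] by (rule grad_x_has_derivative[OF assms(2) that])
    show "G (\<alpha>, x) \<noteq> 0" if "(\<alpha>, x) \<in> D" for \<alpha> x
      using assms(3) that unfolding G(2)[OF that] nonstationary_def by blast
    show "det2 (G (\<alpha>, x)) (G (\<beta>, x)) * det2 (G (\<beta>, x)) (G (\<gamma>, x)) * det2 (G (\<alpha>, x)) (G (\<gamma>, x)) > 0"
      if "(\<alpha>, x) \<in> D" "(\<beta>, x) \<in> D" "(\<gamma>, x) \<in> D" "\<alpha> < \<beta>" "\<beta> < \<gamma>" for \<alpha> \<beta> \<gamma> x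
      unfolding that(1-3)[THEN G(2)] by (rule angle_monotone_det2[OF assms(4,3) that])
  qed
  define F' where "F' = (\<Union>\<alpha>. {\<alpha>} \<times> F \<alpha>)"
  \<comment> \<open>Outer regularity of Lebesgue measure.\<close>
  have "\<exists>Q. open Q \<and> F' \<subseteq> Q \<and> Q - F' \<in> lmeasurable \<and> emeasure lebesgue (Q - F') < ennreal ((1 / 2) ^ n)" for n :: nat
  proof (rule sets_lebesgue_outer_open[OF assms(9)])
    show "0 < (1 / 2 :: real) ^ n" by simp
  qed (auto simp: F'_def)
  then obtain Q where Q: "\<And>n. open (Q n)" "\<And>n. F' \<subseteq> Q n" "\<And>n. Q n - F' \<in> lmeasurable"
    "\<And>n. emeasure lebesgue (Q n - F') < ennreal ((1 / 2) ^ n)"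
    by metis
  have F': "\<exists>x. (\<alpha>, x) \<in> D \<and> \<phi> (\<alpha>, x) = t" if "(\<alpha>, t) \<in> F'" for \<alpha> t
  proof -
    have "t \<in> (\<lambda>x. \<phi> (\<alpha>, x)) ` slice D \<alpha>" using that assms(8) unfolding F'_def by blast
    then show ?thesis by (auto simp: slice_def)
  qed
  obtain E where E: "E \<in> sets borel" "F' \<subseteq> curves E"
    "\<And>n. \<exists>W. open W \<and> E \<subseteq> W \<and> emeasure lborel (excess (Q n) (real n) W) \<le> ennreal ((1 / 2) ^ n)"
  proof (rule exists_efficient_cover[of F' Q, OF F' Q(1,2)])
    fix E assume "E \<in> sets borel" "F' \<subseteq> curves E"
      "\<And>n. \<exists>W. open W \<and> E \<subseteq> W \<and> emeasure lborel (excess (Q n) (real n) W) \<le> ennreal ((1 / 2) ^ n)"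
    then show thesis by (rule that)
  qed
  have neg: "negligible (curves E - F')"
  proof (rule negligible_if_eventually_small)
    fix m :: nat
    show "\<forall>\<^sub>F n in sequentially. \<exists>T\<in>sets lebesgue. (curves E - F') \<inter> ({-real m..real m} \<times> UNIV) \<subseteq> T
      \<and> emeasure lebesgue T \<le> ennreal (2 * (1 / 2) ^ n)"
      using eventually_ge_at_top[of m]
    proof eventually_elim
      case (elim n)
      obtain W where W: "open W" "E \<subseteq> W" "emeasure lborel (excess (Q n) (real n) W) \<le> ennreal ((1 / 2) ^ n)"
        using E(3) by blast
      have X: "excess (Q n) (real n) W \<in> sets borel" using excess_borel[OF Q(1) W(1)] .
      \<comment> \<open>Two errors of at most \<open>1 / 2 ^ n\<close>: what leaves
        \<open>Q n\<close>, and what \<open>Q n\<close> has beyond \<open>F'\<close>. As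
        \<open>n\<close> is at least \<open>m\<close>, the slab of the excess contains the given
        one.\<close>
      let ?T = "excess (Q n) (real n) W \<union> (Q n - F')"
      have "(curves E - F') \<inter> ({-real m..real m} \<times> UNIV) \<subseteq> ?T"
        using curves_mono[OF W(2)] elim by (auto simp: excess_def)
      moreover have T: "?T \<in> sets lebesgue" using X Q(3)[of n] by auto
      moreover have "emeasure lebesgue ?T \<le> ennreal ((1 / 2) ^ n) + ennreal ((1 / 2) ^ n)"
      proof (rule order_trans[OF emeasure_subadditive add_mono])
        show "emeasure lebesgue (excess (Q n) (real n) W) \<le> ennreal ((1 / 2) ^ n)"
          using W(3) X by simp
        show "emeasure lebesgue (Q n - F') \<le> ennreal ((1 / 2) ^ n)" using Q(4)[of n] by simp
      qed (use X Q(3)[of n] in auto)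
      then have "emeasure lebesgue ?T \<le> ennreal (2 * (1 / 2) ^ n)"
        by (simp flip: ennreal_plus)
      ultimately show ?case by blast
    qed
  qed
  show ?thesis
  proof (intro exI[of _ E] conjI allI E(1))
    show "F \<alpha> \<subseteq> (\<lambda>x. \<phi> (\<alpha>, x)) ` (E \<inter> slice D \<alpha>)" for \<alpha>
    proof
      fix t assume "t \<in> F \<alpha>"
      then have "(\<alpha>, t) \<in> curves E" using E(2) by (auto simp: F'_def)
      then show "t \<in> (\<lambda>x. \<phi> (\<alpha>, x)) ` (E \<inter> slice D \<alpha>)"
        by (auto simp: curves_def slice_def)
    qed
    show "AE \<alpha> in lebesgue. (\<lambda>x. \<phi> (\<alpha>, x)) ` (E \<inter> slice D \<alpha>) - F \<alpha> \<in> null_sets lebesgue"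
      using AE_slice_null[OF neg]
    proof eventually_elim
      case (elim \<alpha>)
      have "(\<lambda>x. \<phi> (\<alpha>, x)) ` (E \<inter> slice D \<alpha>) - F \<alpha> \<subseteq> {t. (\<alpha>, t) \<in> curves E - F'}"
        by (auto simp: curves_def slice_def F'_def)
      then show ?case using elim by (rule null_sets_completion_subset)
    qed
  qed
qed

end
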